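(* Consider the plant $\dot x=Ax+Bu+Ep(q)+E_ww$, $y=Cx+F_ww$, $q=C_qx$ (i.e. $D=\mathbf 0$), where $p$ is globally Lipschitz continuous and the disturbance satisfies $\|w\|_\infty\le\omega_0$ for an arbitrary given $\omega_0>0$. Suppose there exist $\alpha_0>0$, $\mu>0$, a symmetric $P>0$ in $\mathbb{R}^{2n_x\times2n_x}$ and matrices $K_1,K_2,L_1,L_2$ such that, for the continuous-time closed-loop system formed by the plant, the observer $\dot{\hat x}=A\hat x+Bu+Ep(\hat q+L_1(\hat y-y))+L_2(\hat y-y)$, $\hat y=C\hat x$, $\hat q=C_q\hat x$, and the controller $u=K_1\hat x+K_2p(C_q\hat x)$, the function $V(z)=z^\top Pz$ with $z=(x^\top,(x-\hat x)^\top)^\top$ satisfies $\dot V\le-\alpha_0V+\mu\|w\|^2$ along its trajectories. Now consider the implementation with two asynchronous event-triggering mechanisms: output sampling times $t_0^y=0<t_1^y<\cdots$ with $y_s(t)=y(t_k^y)$ for $t\in[t_k^y,t_{k+1}^y)$ and $t_{k+1}^y=\inf\{t\mid t\ge t_k^y+\tau_y,\ \|y_s(t)-y(t)\|>\sigma_y\|y(t)\|+\epsilon_y\}$; observer $\dot{\hat x}=A\hat x+Bu+Ep(\hat q+L_1(\hat y-y_s))+L_2(\hat y-y_s)$, $\hat y=C\hat x$, $\hat q=C_q\hat x$; controller update times $t_0^u=0<t_1^u<\cdots$ with $\hat x_s(t)=\hat x(t_k^u)$ for $t\in[t_k^u,t_{k+1}^u)$, $t_{k+1}^u=\inf\{t\mid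 t\ge t_k^u+\tau_u,\ \|\hat x_s(t)-\hat x(t)\|>\sigma_u\|\hat x(t)\|+\epsilon_u\}$, and input $u(t)=K_1\hat x_s(t)+K_2p(C_q\hat x_s(t))$. Then positive numbers $\tau_y,\sigma_y,\epsilon_y,\tau_u,\sigma_u,\epsilon_u$ can be chosen such that this event-triggered closed-loop system is input-to-state practically stable with respect to $w$.
   Context: Plant: $x\in\mathbb{R}^{n_x}$ state, $u\in\mathbb{R}^{n_u}$ input, $y\in\mathbb{R}^{n_y}$ output, $w\in\mathbb{R}^{n_w}$ unknown measurable disturbance; $A,B,C,C_q,E,E_w,F_w$ constant real matrices of compatible sizes; $p:\mathbb{R}^{n_q}\to\mathbb{R}^{n_p}$ known with $p(0)=0$. The closed loop is input-to-state practically stable (ISpS) w.r.t. $w$ if there exist $\beta_1\in\mathcal{KL}$, $\beta_2\in\mathcal K$ and a constant $d\ge0$ such that for every initial condition $(x(0),\hat x(0))$ and every admissible disturbance $w$, $\|z(t)\|\le\beta_1(\|z(0)\|,t)+\beta_2(\|w\|_\infty)+d$ for all $t\ge0$, where $z=(x^\top,(x-\hat x)^\top)^\top$ and $\|w\|_\infty=\sup_{t\ge0}\|w(t)\|$. *)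

theory Defs
  imports "HOL-Analysis.Analysis"
begin

text \<open>Concatenation of two vectors in R^n into a vector in R^(2n).\<close>
definition cat :: "real^'n \<Rightarrow> real^'n \<Rightarrow> real^('n + 'n)" where
  "cat a b = (\<chi> i. case i of Inl j \<Rightarrow> a $ j | Inr j \<Rightarrow> b $ j)"

text \<open>Comparison functions (defined on [0,oo)).\<close>
definition classK :: "(real \<Rightarrow> real) \<Rightarrow> bool" where
  "classK \<alpha> \<longleftrightarrow> continuous_on {0..} \<alpha> \<and> \<alpha> 0 = 0 \<and> strict_mono_on {0..} \<alpha>"

definition classKL :: "(real \<Rightarrow> real \<Rightarrow> real) \<Rightarrow> bool" where
  "classKL \<beta> \<longleftrightarrow> (\<forall>t\<ge>0. classK (\<lambda>r. \<beta> r t)) \<and>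
     (\<forall>r\<ge>0. (\<forall>s t. 0 \<le> s \<and> s \<le> t \<longrightarrow> \<beta> r t \<le> \<beta> r s) \<and> ((\<beta> r) \<longlongrightarrow> 0) at_top)"

text \<open>Sup norm of a disturbance over [0,oo), and admissible disturbances.\<close>
definition winf :: "(real \<Rightarrow> 'a::real_normed_vector) \<Rightarrow> real" where
  "winf w = (SUP t\<in>{0..}. norm (w t))"

definition admissible :: "real \<Rightarrow> (real \<Rightarrow> 'a::euclidean_space) \<Rightarrow> bool" where
  "admissible \<omega>0 w \<longleftrightarrow> w \<in> borel_measurable lebesgue \<and> (\<forall>t\<ge>0. norm (w t) \<le> \<omega>0)"

text \<open>Event-triggering rule: t_0 = 0 and
  t_(k+1) = inf {t | t >= t_k + tau, ||sig(t_k) - sig(t)|| > sigma ||sig(t)|| + eps};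
  times are extended reals (inf of the empty set = oo: no further event).\<close>
definition trig :: "real \<Rightarrow> real \<Rightarrow> real \<Rightarrow> (real \<Rightarrow> 'a::real_normed_vector) \<Rightarrow> (nat \<Rightarrow> ereal) \<Rightarrow> bool" where
  "trig \<tau> \<sigma> \<epsilon> sig ts \<longleftrightarrow> ts 0 = 0 \<and>
     (\<forall>k. ts (Suc k) = (if ts k = \<infinity> then \<infinity> else
        Inf (ereal ` {t. real_of_ereal (ts k) + \<tau> \<le> t \<and>
               \<sigma> * norm (sig t) + \<epsilon> < norm (sig (real_of_ereal (ts k)) - sig t)})))"

text \<open>Zero-order hold: hs(t) = sig(t_k) for t in [t_k, t_(k+1)).\<close>
definition held :: "(nat \<Rightarrow> ereal) \<Rightarrow> (real \<Rightarrow> 'a) \<Rightarrow> (real \<Rightarrow> 'a) \<Rightarrow> bool" where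
  "held ts sig hs \<longleftrightarrow> (\<forall>k t. ts k \<le> ereal t \<and> ereal t < ts (Suc k) \<longrightarrow> hs t = sig (real_of_ereal (ts k)))"

text \<open>(x, xh) is a solution on [0,oo) of the event-triggered closed loop with disturbance w
  (Caratheodory sense: integral equations).\<close>
definition et_solution ::
  "real^'nx^'nx \<Rightarrow> real^'nu^'nx \<Rightarrow> real^'nx^'ny \<Rightarrow> real^'nx^'nq \<Rightarrow> real^'np^'nx \<Rightarrow>
   real^'nw^'nx \<Rightarrow> real^'nw^'ny \<Rightarrow> (real^'nq \<Rightarrow> real^'np) \<Rightarrow>
   real^'nx^'nu \<Rightarrow> real^'np^'nu \<Rightarrow> real^'ny^'nq \<Rightarrow> real^'ny^'nx \<Rightarrow>
   real \<Rightarrow> real \<Rightarrow> real \<Rightarrow> real \<Rightarrow> real \<Rightarrow> real \<Rightarrow>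
   (real \<Rightarrow> real^'nx) \<Rightarrow> (real \<Rightarrow> real^'nx) \<Rightarrow> (real \<Rightarrow> real^'nw) \<Rightarrow> bool" where
  "et_solution A B C Cq E Ew Fw p K1 K2 L1 L2 \<tau>y \<sigma>y \<epsilon>y \<tau>u \<sigma>u \<epsilon>u x xh w \<longleftrightarrow>
    (\<exists>ty tu ys xhs.
      (let y = (\<lambda>t. C *v x t + Fw *v w t);
           u = (\<lambda>t. K1 *v xhs t + K2 *v p (Cq *v xhs t)) in
       trig \<tau>y \<sigma>y \<epsilon>y y ty \<and> held ty y ys \<and>
       trig \<tau>u \<sigma>u \<epsilon>u xh tu \<and> held tu xh xhs \<and>
       (\<forall>t\<ge>0.
          ((\<lambda>s. A *v x s + B *v u s + E *v p (Cq *v x s) + Ew *v w s)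
             has_integral (x t - x 0)) {0..t} \<and>
          ((\<lambda>s. A *v xh s + B *v u s
                 + E *v p (Cq *v xh s + L1 *v (C *v xh s - ys s))
                 + L2 *v (C *v xh s - ys s))
             has_integral (xh t - xh 0)) {0..t})))"

text \<open>Input-to-state practical stability w.r.t. w (admissible: measurable, sup-norm at most omega0).\<close>
definition ISpS :: "real \<Rightarrow> ((real \<Rightarrow> real^'nx) \<Rightarrow> (real \<Rightarrow> real^'nx) \<Rightarrow> (real \<Rightarrow> real^'nw) \<Rightarrow> bool) \<Rightarrow> bool" where
  "ISpS \<omega>0 sol \<longleftrightarrow> (\<exists>\<beta>1 \<beta>2 d. classKL \<beta>1 \<and> classK \<beta>2 \<and> d \<ge> 0 \<and>
     (\<forall>x xh w. admissible \<omega>0 w \<and> sol x xh w \<longrightarrow>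
        (\<forall>t\<ge>0. norm (cat (x t) (x t - xh t))
                 \<le> \<beta>1 (norm (cat (x 0) (x 0 - xh 0))) t + \<beta>2 (winf w) + d)))"

end

theory Submission
  imports Defs
begin

text \<open>Between two events the held signals differ from the current ones either by at most the
  threshold \<open>\<sigma> \<parallel>s\<parallel> + \<epsilon>\<close>, or, during the dwell time \<open>\<tau>\<close>, by the motion of the state over a time
  \<open>\<tau>\<close>.  Both errors are bounded by \<open>(\<sigma> + \<tau>)\<close> times the size of \<open>z\<close> on a recent window plus a
  constant, and the closed-loop vector field is globally Lipschitz, so the nominal dissipation
  inequality for \<open>V z = z\<^sup>T P z\<close> survives as a delay-type inequality with small gain in the
  window supremum.  A Razumikhin-type comparison on consecutive intervals of length \<open>\<tau>\<close> then gives
  \<open>V (z t) \<le> V (z 0) exp (- a t) + b\<close>; the bounded disturbance and the absolute thresholds only enter the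
  constant \<open>b\<close>, i.e. the offset \<open>d\<close> of practical stability.\<close>

section \<open>Block vectors and matrices\<close>

lemma cat_nth [simp]: "cat a b $ Inl j = a $ j" "cat a b $ Inr j = b $ j"
  unfolding cat_def by auto

lemma inner_cat: "cat a b \<bullet> cat c d = a \<bullet> c + b \<bullet> d"
proof -
  have "cat a b \<bullet> cat c d = (\<Sum>i\<in>Inl ` UNIV \<union> Inr ` UNIV. cat a b $ i * cat c d $ i)"
    unfolding inner_vec_def UNIV_sum[symmetric] by simp
  also have "\<dots> = (\<Sum>i\<in>Inl ` UNIV. cat a b $ i * cat c d $ i) + (\<Sum>i\<in>Inr ` UNIV. cat a b $ i * cat c d $ i)"
    by (rule sum.union_disjoint) auto
  also have "\<dots> = a \<bullet> c + b \<bullet> d"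
    by (simp add: sum.reindex inner_vec_def)
  finally show ?thesis .
qed

lemma norm_cat_squared: "(norm (cat a b))\<^sup>2 = (norm a)\<^sup>2 + (norm b)\<^sup>2"
  by (simp add: power2_norm_eq_inner inner_cat)

lemma norm_cat_ge_left: "norm a \<le> norm (cat a b)"
  using norm_cat_squared[of a b] by (smt (verit) norm_ge_zero power2_le_imp_le zero_le_power2)

lemma norm_cat_ge_right: "norm b \<le> norm (cat a b)"
  using norm_cat_squared[of a b] by (smt (verit) norm_ge_zero power2_le_imp_le zero_le_power2)

lemma norm_cat_le: "norm (cat a b) \<le> norm a + norm b"
proof -
  have "(norm (cat a b))\<^sup>2 \<le> (norm a + norm b)\<^sup>2"
    unfolding norm_cat_squared by (simp add: power2_eq_square algebra_simps)
  then show ?thesis by (rule power2_le_imp_le) simp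
qed

lemma norm_le_twice_norm_cat_diff: "norm b \<le> 2 * norm (cat a (a - b))"
proof -
  have "norm b \<le> norm a + norm (a - b)"
    by (metis norm_triangle_sub add_diff_cancel_left' diff_add_cancel norm_minus_commute)
  then show ?thesis using norm_cat_ge_left[of a "a - b"] norm_cat_ge_right[of "a - b" a] by linarith
qed

lemma cat_add: "cat (a + c) (b + d) = cat a b + cat c d"
  by (simp add: vec_eq_iff cat_def split: sum.splits)

lemma cat_diff: "cat (a - c) (b - d) = cat a b - cat c d"
  by (simp add: vec_eq_iff cat_def split: sum.splits)

lemma has_integral_cat:
  assumes "(f has_integral i) S" "(g has_integral j) S"
  shows "((\<lambda>s. cat (f s) (g s)) has_integral cat i j) S"
proof -
  have "linear (\<lambda>a. cat a 0)" "linear (\<lambda>b. cat 0 b)"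
    by (rule linearI; simp add: vec_eq_iff cat_def split: sum.splits)+
  then have "((\<lambda>s. cat (f s) 0) has_integral cat i 0) S" "((\<lambda>s. cat 0 (g s)) has_integral cat 0 j) S"
    using has_integral_linear[OF assms(1)] has_integral_linear[OF assms(2)]
    by (simp_all add: o_def linear_conv_bounded_linear)
  from has_integral_add[OF this] show ?thesis
    by (simp add: cat_add[symmetric])
qed

lemma onorm_matrix_nonneg: "0 \<le> onorm ((*v) M)" for M :: "real^'n^'m"
  by (rule onorm_pos_le[OF matrix_vector_mul_bounded_linear])

lemma norm_matrix_vector_le: "onorm ((*v) M) \<le> c \<Longrightarrow> norm (M *v v) \<le> c * norm v" for M :: "real^'n^'m"
  by (meson onorm[OF matrix_vector_mul_bounded_linear] mult_right_mono norm_ge_zero order_trans)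

lemma symmetric_matrix_inner_commute:
  fixes P :: "real^'m^'m"
  assumes "transpose P = P"
  shows "a \<bullet> (P *v b) = b \<bullet> (P *v a)"
proof -
  have "a \<bullet> (P *v b) = (a v* P) \<bullet> b" by (simp add: dot_lmul_matrix)
  also have "a v* P = P *v a" using vector_transpose_matrix[of a P] assms by simp
  finally show ?thesis by (simp add: inner_commute)
qed

lemma posdef_quadratic_form_coercive:
  fixes P :: "real^'m^'m"
  assumes pos: "\<And>z. z \<noteq> 0 \<Longrightarrow> z \<bullet> (P *v z) > 0"
  shows "\<exists>l>0. \<forall>v. l * (norm v)\<^sup>2 \<le> v \<bullet> (P *v v)"
proof -
  have cont: "continuous_on (sphere 0 1) (\<lambda>v::real^'m. v \<bullet> (P *v v))"
    by (intro continuous_intros linear_continuous_on matrix_vector_mul_bounded_linear)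
  obtain v0 where v0: "v0 \<in> sphere 0 1" "\<forall>v\<in>sphere 0 1. v0 \<bullet> (P *v v0) \<le> v \<bullet> (P *v v)"
    using continuous_attains_inf[OF compact_sphere _ cont] by auto
  have "(v0 \<bullet> (P *v v0)) * (norm v)\<^sup>2 \<le> v \<bullet> (P *v v)" for v
  proof (cases "v = 0")
    case False
    define u where "u = (1 / norm v) *\<^sub>R v"
    have vu: "v = norm v *\<^sub>R u" unfolding u_def using False by simp
    have "v \<bullet> (P *v v) = (norm v)\<^sup>2 * (u \<bullet> (P *v u))"
      by (subst vu, subst vu) (simp add: matrix_vector_mult_scaleR power2_eq_square algebra_simps)
    moreover have "u \<in> sphere 0 1" unfolding u_def using False by simp
    then have "v0 \<bullet> (P *v v0) \<le> u \<bullet> (P *v u)" using v0(2) by blast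
    ultimately show ?thesis
      using mult_right_mono[OF _ zero_le_power2, of "v0 \<bullet> (P *v v0)" "u \<bullet> (P *v u)" "norm v"]
      by (simp add: mult.commute)
  qed simp
  moreover have "v0 \<noteq> 0" using v0(1) by auto
  then have "v0 \<bullet> (P *v v0) > 0" by (rule pos)
  ultimately show ?thesis by blast
qed

lemma has_integral_from_zero_on_subinterval:
  fixes f :: "real \<Rightarrow> 'a::banach"
  assumes I: "\<And>t. t \<ge> 0 \<Longrightarrow> (f has_integral (X t - X 0)) {0..t}" and "0 \<le> s" "s \<le> t"
  shows "(f has_integral (X t - X s)) {s..t}"
proof -
  have it: "f integrable_on {0..t}" using I[of t] assms(2,3) by (auto intro: has_integral_integrable)
  have "integral {0..s} f + integral {s..t} f = integral {0..t} f"
    by (rule Henstock_Kurzweil_Integration.integral_combine[OF assms(2,3) it])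
  moreover have "integral {0..s} f = X s - X 0" "integral {0..t} f = X t - X 0"
    using I assms by (simp_all add: integral_unique)
  moreover have "f integrable_on {s..t}" by (rule integrable_subinterval_real[OF it]) (use assms in auto)
  ultimately show ?thesis by (metis has_integral_integrable_integral add_diff_cancel_left' diff_diff_eq2 diff_add_cancel)
qed

lemma norm_matrix_vector_diff_le:
  fixes M :: "real^'n^'m"
  assumes "\<And>v. norm (M *v v) \<le> c * norm v" "0 \<le> c" "norm (a - b) \<le> d"
  shows "norm (M *v a - M *v b) \<le> c * d"
  using assms(1)[of "a - b"] mult_left_mono[OF assms(3,2)]
  by (simp add: matrix_vector_mult_diff_distrib)

lemma norm_add_le_bounds: "norm a \<le> x \<Longrightarrow> norm b \<le> y \<Longrightarrow> norm (a + b) \<le> x + y"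
  by (meson add_mono norm_triangle_ineq order_trans)

lemma norm_diff_le_bounds: "norm a \<le> x \<Longrightarrow> norm b \<le> y \<Longrightarrow> norm (a - b) \<le> x + y"
  by (meson add_mono norm_triangle_ineq4 order_trans)

lemma affine_le_linear_bound:
  fixes M c c' D :: real
  assumes "0 \<le> M" "0 \<le> c" "c \<le> D" "c' \<le> D"
  shows "c * M + c' \<le> D * (M + 1)"
  using mult_right_mono[OF assms(3,1)] assms(4) by (simp add: algebra_simps)

section \<open>Comparison functions\<close>

lemma classK_linear: "c > 0 \<Longrightarrow> classK (\<lambda>r. c * r)"
  unfolding classK_def by (auto intro!: continuous_intros simp: strict_mono_on_def)

lemma classKL_exponential:
  fixes c a :: real
  assumes c: "c > 0" and a: "a > 0"
  shows "classKL (\<lambda>r t. c * r * exp (- a * t))"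
  unfolding classKL_def
proof (intro conjI allI impI)
  fix t :: real
  show "classK (\<lambda>r. c * r * exp (- a * t))"
    using classK_linear[of "c * exp (- a * t)"] c by (simp add: ac_simps)
next
  fix r s t :: real assume "r \<ge> 0" "0 \<le> s \<and> s \<le> t"
  then show "c * r * exp (- a * t) \<le> c * r * exp (- a * s)"
    using c a by (intro mult_left_mono) auto
next
  fix r :: real
  have "filterlim (\<lambda>t. - a * t) at_bot at_top"
    using filterlim_tendsto_neg_mult_at_bot[OF tendsto_const[of "- a"] _ filterlim_ident] a by simp
  then have "((\<lambda>t. exp (- a * t)) \<longlongrightarrow> 0) at_top"
    by (rule filterlim_compose[OF exp_at_bot])
  then show "((\<lambda>t. c * r * exp (- a * t)) \<longlongrightarrow> 0) at_top"
    by (rule tendsto_mult_right_zero)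
qed

lemma winf_nonneg:
  assumes "admissible \<omega>0 w"
  shows "winf w \<ge> 0"
proof -
  have "bdd_above ((\<lambda>t. norm (w t)) ` {0..})"
    using assms unfolding admissible_def by (intro bdd_aboveI[of _ \<omega>0]) auto
  then have "norm (w 0) \<le> winf w" unfolding winf_def by (intro cSUP_upper) auto
  then show ?thesis by (meson norm_ge_zero order_trans)
qed

lemma ISpS_of_exponential_bound:
  assumes c: "0 < c" and a: "0 < a" and d: "0 \<le> d"
    and bound: "\<And>x xh w t. admissible \<omega>0 w \<Longrightarrow> sol x xh w \<Longrightarrow> 0 \<le> t \<Longrightarrow>
      norm (cat (x t) (x t - xh t)) \<le> c * norm (cat (x 0) (x 0 - xh 0)) * exp (- a * t) + d"
  shows "ISpS \<omega>0 sol"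
  unfolding ISpS_def
proof (intro exI[of _ "\<lambda>r t. c * r * exp (- a * t)"] exI[of _ "\<lambda>r. 1 * r"] exI[of _ d]
    conjI allI impI)
  show "classKL (\<lambda>r t. c * r * exp (- a * t))" by (rule classKL_exponential[OF c a])
  show "classK (\<lambda>r::real. 1 * r)" by (rule classK_linear) simp
  show "0 \<le> d" by (rule d)
  fix x xh w and t :: real
  assume "admissible \<omega>0 w \<and> sol x xh w" and "0 \<le> t"
  then show "norm (cat (x t) (x t - xh t)) \<le> c * norm (cat (x 0) (x 0 - xh 0)) * exp (- a * t) + 1 * winf w + d"
    using bound[of w x xh t] winf_nonneg[of \<omega>0 w] by auto
qed

section \<open>Event-triggered sampling\<close>

lemma trig_time_ge:
  assumes tr: "trig \<tau> \<sigma> \<epsilon> sig ts" and tau: "\<tau> > 0"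
  shows "ts k = \<infinity> \<or> (\<exists>t. ts k = ereal t \<and> real k * \<tau> \<le> t)"
proof (induction k)
  case 0
  then show ?case using tr unfolding trig_def by auto
next
  case (Suc k)
  show ?case
  proof (cases "ts k = \<infinity>")
    case True
    then show ?thesis using tr unfolding trig_def by auto
  next
    case False
    then obtain t where t: "ts k = ereal t" "real k * \<tau> \<le> t" using Suc by auto
    define S where "S = {t'. t + \<tau> \<le> t' \<and> \<sigma> * norm (sig t') + \<epsilon> < norm (sig t - sig t')}"
    have eq: "ts (Suc k) = Inf (ereal ` S)" using tr t unfolding trig_def S_def by auto
    show ?thesis
    proof (cases "S = {}")
      case True
      then show ?thesis using eq by (simp add: top_ereal_def)
    next
      case False
      then obtain s0 where "s0 \<in> S" by auto
      then have up: "Inf (ereal ` S) \<le> ereal s0" by (intro Inf_lower) auto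
      have lo: "ereal (t + \<tau>) \<le> Inf (ereal ` S)" by (rule Inf_greatest) (auto simp: S_def)
      then obtain e where e: "Inf (ereal ` S) = ereal e" using up by (cases "Inf (ereal ` S)") auto
      then have "real (Suc k) * \<tau> \<le> e" using lo t by (simp add: algebra_simps)
      then show ?thesis using eq e by auto
    qed
  qed
qed

text \<open>Events are at least \<open>\<tau>\<close> apart, so only finitely many precede \<open>r\<close>; the last one is the
  sampling time \<open>t0\<close>, and past the dwell time the triggering condition cannot have fired yet.\<close>
lemma held_sample_time:
  fixes sig :: "real \<Rightarrow> 'a::real_normed_vector"
  assumes tr: "trig \<tau> \<sigma> \<epsilon> sig ts" and hd: "held ts sig hs" and tau: "\<tau> > 0" and r0: "r \<ge> 0"
  shows "\<exists>t0. 0 \<le> t0 \<and> t0 \<le> r \<and> hs r = sig t0 \<and>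
           (r < t0 + \<tau> \<or> norm (sig t0 - sig r) \<le> \<sigma> * norm (sig r) + \<epsilon>)"
proof -
  define Ks where "Ks = {k. ts k \<le> ereal r}"
  have "0 \<in> Ks" using tr r0 unfolding trig_def Ks_def by (simp add: zero_ereal_def)
  have "k \<le> nat \<lceil>r / \<tau>\<rceil>" if "k \<in> Ks" for k
  proof -
    have "ts k \<le> ereal r" using that Ks_def by simp
    then obtain t where "ts k = ereal t" "real k * \<tau> \<le> t" "t \<le> r"
      using trig_time_ge[OF tr tau, of k] by auto
    then have "real k \<le> r / \<tau>" using tau by (simp add: field_simps)
    then show ?thesis by linarith
  qed
  then have fin: "finite Ks" by (meson atMost_iff finite_atMost finite_subset subsetI)
  define k where "k = Max Ks"
  have le: "ts k \<le> ereal r" using Max_in[OF fin] \<open>0 \<in> Ks\<close> unfolding k_def Ks_def by auto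
  have gt: "ereal r < ts (Suc k)" using Max_ge[OF fin, of "Suc k"] unfolding k_def Ks_def by force
  obtain t0 where t0: "ts k = ereal t0" "real k * \<tau> \<le> t0"
    using trig_time_ge[OF tr tau, of k] le by auto
  have "0 \<le> t0" using t0(2) tau by (meson order_trans mult_nonneg_nonneg of_nat_0_le_iff less_imp_le)
  moreover have "t0 \<le> r" using le t0 by auto
  moreover have "hs r = sig t0" using hd le gt t0 unfolding held_def by (metis real_of_ereal.simps(1))
  moreover have "r < t0 + \<tau> \<or> norm (sig t0 - sig r) \<le> \<sigma> * norm (sig r) + \<epsilon>"
  proof (rule ccontr)
    assume "\<not> ?thesis"
    then have "Inf (ereal ` {t'. t0 + \<tau> \<le> t' \<and> \<sigma> * norm (sig t') + \<epsilon> < norm (sig t0 - sig t')}) \<le> ereal r"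
      by (intro Inf_lower) auto
    then show False using gt tr t0 unfolding trig_def by auto
  qed
  ultimately show ?thesis by blast
qed

section \<open>Decay under window-dependent bounds\<close>

lemma norm_squared_ge_of_close:
  fixes a b :: "'a::real_normed_vector"
  assumes a: "norm a \<le> M" and ab: "norm (a - b) \<le> d" and d: "0 \<le> d"
  shows "(norm a)\<^sup>2 - 2 * M * d \<le> (norm b)\<^sup>2"
proof -
  have close: "norm a - d \<le> norm b" using ab norm_triangle_sub[of a b] by (simp add: norm_minus_commute)
  have "(norm a)\<^sup>2 - 2 * norm a * d \<le> (norm b)\<^sup>2"
  proof (cases "d \<le> norm a")
    case True
    have "(norm a - d)\<^sup>2 \<le> (norm b)\<^sup>2" using close True by (intro power_mono) auto
    then have "(norm a)\<^sup>2 + d\<^sup>2 - 2 * norm a * d \<le> (norm b)\<^sup>2" by (simp add: power2_diff)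
    then show ?thesis using zero_le_power2[of d] by linarith
  next
    case False
    then have "norm a * (norm a - 2 * d) \<le> 0" using d by (intro mult_nonneg_nonpos) auto
    then have "(norm a)\<^sup>2 - 2 * norm a * d \<le> 0" by (simp add: power2_eq_square algebra_simps)
    then show ?thesis using zero_le_power2[of "norm b"] by linarith
  qed
  moreover have "norm a * d \<le> M * d" using a d by (rule mult_right_mono)
  ultimately show ?thesis by linarith
qed

text \<open>Decay of a quadratic Lyapunov function \<open>V\<close> along a trajectory \<open>z\<close> whose derivative \<open>G\<close>
  is controlled by the sup of \<open>\<parallel>z\<parallel>\<close> over a window of length \<open>h\<close> (resp. \<open>2h\<close>) into the past,
  as for a system with sampled feedback.  The constants are fixed first, in \<open>window_decay\<close>,
  so that \<open>decay_rate\<close> and \<open>offset\<close> do not depend on the trajectory.\<close>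
locale window_decay =
  fixes P :: "real^'m^'m" and al la La K C eta h :: real
  assumes al_pos: "al > 0" and la_pos: "la > 0" and La_pos: "La > 0"
    and K_pos: "K > 0" and C_nonneg: "C \<ge> 0" and eta_nonneg: "eta \<ge> 0" and h_pos: "h > 0"
    and quad_lower: "\<And>v. la * (norm v)\<^sup>2 \<le> v \<bullet> (P *v v)"
    and quad_upper: "\<And>a b. \<bar>a \<bullet> (P *v b)\<bar> \<le> La * norm a * norm b"
    and P_symmetric: "\<And>a b. a \<bullet> (P *v b) = b \<bullet> (P *v a)"
    and h_K: "h * K \<le> 1/4" and h_al: "h * al \<le> La"
    and xi_small: "64 * La * (8*al*h*K + 4*eta + 8*La*h*K\<^sup>2) \<le> al * la"
begin

definition V :: "real^'m \<Rightarrow> real" where "V v = v \<bullet> (P *v v)"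
definition xi :: real where "xi = 8*al*h*K + 4*eta + 8*La*h*K\<^sup>2"
definition decay_rate :: real where "decay_rate = al / (4 * La)"
definition offset :: real where
  "offset = 8 * La * (2 * xi + 2 * C + C\<^sup>2 / (al * la / (32 * La))) / al"

lemma V_diff: "V a - V b = (a - b) \<bullet> (P *v (a + b))"
  unfolding V_def using P_symmetric[of a b]
  by (simp add: matrix_vector_right_distrib inner_diff_left inner_add_right)

lemma V_lower: "la * (norm v)\<^sup>2 \<le> V v"
  unfolding V_def by (rule quad_lower)

lemma V_upper: "V v \<le> La * (norm v)\<^sup>2"
  using quad_upper[of v v] unfolding V_def by (simp add: power2_eq_square mult.assoc)

lemma V_nonneg: "0 \<le> V v"
  using V_lower[of v] la_pos by (smt (verit) mult_nonneg_nonneg zero_le_power2)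

lemma xi_nonneg: "0 \<le> xi"
  unfolding xi_def using al_pos La_pos h_pos K_pos eta_nonneg by auto

lemma offset_nonneg: "0 \<le> offset"
  unfolding offset_def using xi_nonneg C_nonneg al_pos la_pos La_pos by auto

lemma decay_rate_pos: "0 < decay_rate"
  unfolding decay_rate_def using al_pos La_pos by simp

lemma decay_rate_h: "decay_rate * h \<le> 1/4"
  unfolding decay_rate_def using h_al La_pos by (simp add: field_simps)

text \<open>The constant and linear terms produced by the window bound \<open>Pb\<close> are absorbed into a
  fraction of the envelope \<open>Phi\<close>; the square term is small by \<open>xi_small\<close>, the rest by
  \<open>Phi \<ge> offset\<close> and AM-GM.\<close>
lemma forcing_le_decay:
  assumes Phi: "offset \<le> Phi" and Pb: "0 \<le> Pb" "la * Pb\<^sup>2 = 2 * Phi"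
  shows "xi * (Pb+1)\<^sup>2 + 2*C*(Pb+1) \<le> decay_rate * Phi"
proof -
  define dl where "dl = al * la / (32 * La)"
  have dl: "dl > 0" unfolding dl_def using al_pos la_pos La_pos by simp
  have amgm: "2 * C * Pb \<le> dl * Pb\<^sup>2 + C\<^sup>2 / dl"
  proof -
    have "0 \<le> (dl * Pb - C)\<^sup>2 / dl" using dl by simp
    also have "\<dots> = dl * Pb\<^sup>2 - 2 * C * Pb + C\<^sup>2 / dl"
      using dl by (simp add: power2_eq_square field_simps)
    finally show ?thesis by linarith
  qed
  have "(Pb+1)\<^sup>2 \<le> 2 * Pb\<^sup>2 + 2"
    using zero_le_power2[of "Pb - 1"] by (simp add: power2_eq_square algebra_simps)
  then have "xi * (Pb+1)\<^sup>2 \<le> xi * (2 * Pb\<^sup>2 + 2)" by (rule mult_left_mono[OF _ xi_nonneg])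
  then have "xi * (Pb+1)\<^sup>2 + 2*C*(Pb+1) \<le> (2 * xi + dl) * Pb\<^sup>2 + (2 * xi + 2 * C + C\<^sup>2 / dl)"
    using amgm by (simp add: algebra_simps)
  also have "(2 * xi + dl) * Pb\<^sup>2 = (4 * xi / la + al / (16 * La)) * Phi"
    using Pb(2) la_pos La_pos unfolding dl_def by (simp add: field_simps)
  also have "\<dots> \<le> al / (8 * La) * Phi"
  proof (rule mult_right_mono)
    have "4 * xi / la \<le> al / (16 * La)"
      using xi_small la_pos La_pos unfolding xi_def by (simp add: field_simps)
    then show "4 * xi / la + al / (16 * La) \<le> al / (8 * La)" by simp
    show "0 \<le> Phi" using Phi offset_nonneg by linarith
  qed
  also have "2 * xi + 2 * C + C\<^sup>2 / dl = al / (8 * La) * offset"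
    unfolding offset_def dl_def using al_pos La_pos by (simp add: field_simps)
  also have "\<dots> \<le> al / (8 * La) * Phi"
    using Phi al_pos La_pos by (intro mult_left_mono) auto
  finally show ?thesis unfolding decay_rate_def by (simp add: field_simps)
qed

text \<open>One step of the comparison with the envelope: if \<open>V\<close> is large at \<open>s\<close>, the term
  \<open>-al \<parallel>z s\<parallel>\<^sup>2\<close> beats the forcing \<open>X\<close>; if it is small, the step is too short for \<open>V\<close> to catch up.\<close>
lemma envelope_step:
  assumes inc: "Vr \<le> V zs + d * (- al * (norm zs)\<^sup>2 + X)"
    and X: "X \<le> decay_rate * Phi" and Vs: "V zs \<le> Phi" and Phi: "0 \<le> Phi"
    and d: "0 \<le> d" "decay_rate * d \<le> 1/4"
  shows "Vr \<le> (1 - decay_rate * d) * Phi"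
proof (cases "2 * V zs \<ge> Phi")
  case True
  have "Phi / (2 * La) \<le> (norm zs)\<^sup>2" using V_upper[of zs] True La_pos by (simp add: field_simps)
  then have "al * (Phi / (2 * La)) \<le> al * (norm zs)\<^sup>2" using al_pos by (intro mult_left_mono) auto
  then have "- al * (norm zs)\<^sup>2 + X \<le> - decay_rate * Phi"
    using X unfolding decay_rate_def by (simp add: field_simps)
  then have "d * (- al * (norm zs)\<^sup>2 + X) \<le> d * (- decay_rate * Phi)" using d(1) by (rule mult_left_mono)
  then show ?thesis using inc Vs by (simp add: algebra_simps)
next
  case False
  have "0 \<le> al * (norm zs)\<^sup>2" using al_pos by simp
  then have "d * (- al * (norm zs)\<^sup>2 + X) \<le> d * (decay_rate * Phi)"
    using X d(1) by (intro mult_left_mono) auto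
  moreover have "d * (decay_rate * Phi) \<le> 1/4 * Phi"
    using mult_right_mono[OF d(2) Phi] by (simp add: algebra_simps)
  moreover have "3/4 * Phi \<le> (1 - decay_rate * d) * Phi"
    using d(2) Phi by (intro mult_right_mono) auto
  ultimately show ?thesis using inc False by linarith
qed

end

locale window_trajectory = window_decay P al la La K C eta h
  for P :: "real^'m^'m" and al la La K C eta h :: real +
  fixes z G :: "real \<Rightarrow> real^'m"
  assumes z_integral: "\<And>s t. 0 \<le> s \<Longrightarrow> s \<le> t \<Longrightarrow> (G has_integral (z t - z s)) {s..t}"
    and G_bound: "\<And>r M. r \<ge> 0 \<Longrightarrow> (\<forall>q\<in>{max 0 (r-h)..r}. norm (z q) \<le> M) \<Longrightarrow>
        norm (G r) \<le> K * (M + 1)"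
    and G_dissipation: "\<And>r M. r \<ge> 0 \<Longrightarrow> (\<forall>q\<in>{max 0 (r-2*h)..r}. norm (z q) \<le> M) \<Longrightarrow>
        2 * (G r \<bullet> (P *v z r)) \<le> - al * (norm (z r))\<^sup>2 + eta * M\<^sup>2 + C * (M + 1)"
begin

lemma z_continuous: "continuous_on {0..T} z"
proof (cases "0 \<le> T")
  case True
  have "continuous_on {0..T} (\<lambda>t. z 0 + integral {0..t} G)"
    using z_integral[of 0 T] True by (intro continuous_intros indefinite_integral_continuous_1) auto
  moreover have "z t = z 0 + integral {0..t} G" if "t \<in> {0..T}" for t
    using z_integral[of 0 t] that by (simp add: integral_unique)
  ultimately show ?thesis using continuous_on_cong[THEN iffD1, OF refl] by (metis (no_types, lifting))
qed simp

lemma z_increment_bound: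
  assumes "0 \<le> s" "s \<le> q" "\<And>q'. q' \<in> {s..q} \<Longrightarrow> norm (G q') \<le> Kb" "0 \<le> Kb"
  shows "norm (z q - z s) \<le> (q - s) * Kb"
  using has_integral_bound[OF assms(4) z_integral[OF assms(1,2), folded cbox_interval]] assms(2,3)
  by (auto simp: cbox_interval mult.commute)

text \<open>Within one window length the trajectory can at most double (plus one): its speed is
  bounded in terms of its own maximum, and \<open>h K \<le> 1/4\<close>.\<close>
lemma window_growth:
  assumes s0: "0 \<le> s" and sr: "s \<le> r" and rh: "r \<le> s + h" and P0: "0 \<le> P0"
    and past: "\<forall>q\<in>{max 0 (s-h)..s}. norm (z q) \<le> P0"
  shows "\<forall>q\<in>{s..r}. norm (z q) \<le> 2 * P0 + 1"
proof -
  have "continuous_on {s..r} (\<lambda>q. norm (z q))"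
    by (rule continuous_on_norm, rule continuous_on_subset[OF z_continuous[of r]]) (use s0 in auto)
  then obtain qm where qm: "qm \<in> {s..r}" and qmax: "\<forall>q\<in>{s..r}. norm (z q) \<le> norm (z qm)"
    using continuous_attains_sup[of "{s..r}" "\<lambda>q. norm (z q)"] sr by auto
  define M' where "M' = max P0 (norm (z qm))"
  have "norm (G q') \<le> K * (M' + 1)" if "q' \<in> {s..qm}" for q'
  proof (rule G_bound)
    show "q' \<ge> 0" using that s0 by auto
    show "\<forall>q\<in>{max 0 (q'-h)..q'}. norm (z q) \<le> M'"
    proof
      fix q assume q: "q \<in> {max 0 (q'-h)..q'}"
      show "norm (z q) \<le> M'"
      proof (cases "q \<le> s")
        case True
        then have "q \<in> {max 0 (s-h)..s}" using q that by auto
        then show ?thesis using past M'_def by force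
      next
        case False
        then have "q \<in> {s..r}" using q that qm by auto
        then show ?thesis using qmax M'_def by force
      qed
    qed
  qed
  then have "norm (z qm - z s) \<le> (qm - s) * (K * (M' + 1))"
    by (intro z_increment_bound) (use qm s0 K_pos P0 M'_def in auto)
  also have "\<dots> \<le> (h * K) * (M' + 1)"
    using qm rh K_pos P0 unfolding M'_def by (simp add: mult_right_mono)
  also have "\<dots> \<le> (1/4) * (M' + 1)"
    by (rule mult_right_mono[OF h_K]) (use P0 M'_def in auto)
  finally have "norm (z qm - z s) \<le> (M' + 1) / 4" by simp
  moreover have "norm (z s) \<le> P0" using past s0 h_pos by auto
  ultimately have "norm (z qm) \<le> P0 + (M' + 1) / 4"
    using norm_triangle_sub[of "z qm" "z s"] by linarith
  then have "norm (z qm) \<le> 2 * P0 + 1"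
    using P0 unfolding M'_def by (auto simp: max_def field_simps split: if_splits)
  then show ?thesis using qmax by force
qed

lemma window_extend:
  assumes s0: "0 \<le> s" and sr: "s \<le> r" and rh: "r \<le> s + h" and Pb: "0 \<le> Pb"
    and past: "\<forall>q\<in>{max 0 (s-2*h)..s}. norm (z q) \<le> Pb"
  shows "\<forall>q\<in>{max 0 (s-2*h)..r}. norm (z q) \<le> 2 * Pb + 1"
proof
  fix q assume q: "q \<in> {max 0 (s-2*h)..r}"
  show "norm (z q) \<le> 2 * Pb + 1"
  proof (cases "q \<le> s")
    case True
    then show ?thesis using past q Pb by force
  next
    case False
    have "\<forall>q\<in>{max 0 (s-h)..s}. norm (z q) \<le> Pb" using past h_pos by auto
    then show ?thesis using window_growth[OF s0 sr rh Pb] False q by auto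
  qed
qed

text \<open>Freezing the integrand of \<open>V(z r) - V(z s) = \<integral>\<^sub>s\<^sup>r G \<bullet> P (z r + z s)\<close> at \<open>z q\<close>
  costs only \<open>O(h)\<close>, since \<open>z\<close> moves by at most \<open>h K (M + 1)\<close> on \<open>[s, r]\<close>.\<close>
lemma integrand_bound:
  assumes s0: "0 \<le> s" and sr: "s \<le> r" and rh: "r \<le> s + h" and M0: "0 \<le> M"
    and win: "\<forall>q\<in>{max 0 (s-2*h)..r}. norm (z q) \<le> M" and q: "q \<in> {s..r}"
  shows "G q \<bullet> (P *v (z r + z s)) \<le> - al * (norm (z s))\<^sup>2 + 2 * al * M * (h * (K * (M + 1)))
           + eta * M\<^sup>2 + C * (M + 1) + 2 * La * h * (K * (M + 1))\<^sup>2"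
proof -
  define Gm where "Gm = K * (M + 1)"
  have Gm0: "0 \<le> Gm" using K_pos M0 by (simp add: Gm_def)
  have Gb: "norm (G q') \<le> Gm" if "q' \<in> {s..r}" for q'
    unfolding Gm_def by (rule G_bound) (use that s0 h_pos win in auto)
  have inc: "norm (z b - z a) \<le> h * Gm" if "s \<le> a" "a \<le> b" "b \<le> r" for a b
  proof -
    have "norm (z b - z a) \<le> (b - a) * Gm" by (rule z_increment_bound) (use that s0 Gb Gm0 in auto)
    also have "\<dots> \<le> h * Gm" using that rh Gm0 by (intro mult_right_mono) auto
    finally show ?thesis .
  qed
  have cross: "\<bar>G q \<bullet> (P *v (z b - z a))\<bar> \<le> La * Gm * (h * Gm)" if "s \<le> a" "a \<le> b" "b \<le> r" for a b
  proof -
    have "\<bar>G q \<bullet> (P *v (z b - z a))\<bar> \<le> La * norm (G q) * norm (z b - z a)" by (rule quad_upper)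
    also have "\<dots> \<le> La * Gm * (h * Gm)"
      using La_pos Gm0 by (intro mult_mono mult_left_mono Gb[OF q] inc[OF that]) auto
    finally show ?thesis .
  qed
  have "2 * (G q \<bullet> (P *v z q)) \<le> - al * (norm (z q))\<^sup>2 + eta * M\<^sup>2 + C * (M + 1)"
    by (rule G_dissipation) (use q s0 h_pos win in auto)
  moreover have "(norm (z s))\<^sup>2 - 2 * M * (h * Gm) \<le> (norm (z q))\<^sup>2"
    using q win s0 sr h_pos inc[of s q] Gm0
    by (intro norm_squared_ge_of_close) (auto simp: norm_minus_commute)
  then have "- al * (norm (z q))\<^sup>2 \<le> - al * (norm (z s))\<^sup>2 + 2 * al * M * (h * Gm)"
    using mult_left_mono[of _ _ al] al_pos by (fastforce simp: algebra_simps)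
  moreover have "G q \<bullet> (P *v (z r + z s))
      = 2 * (G q \<bullet> (P *v z q)) + G q \<bullet> (P *v (z r - z q)) - G q \<bullet> (P *v (z q - z s))"
    by (simp add: matrix_vector_mult_diff_distrib matrix_vector_right_distrib inner_diff_right
        inner_add_right)
  moreover have "2 * La * h * Gm\<^sup>2 = La * Gm * (h * Gm) + La * Gm * (h * Gm)"
    by (simp add: power2_eq_square)
  moreover have "G q \<bullet> (P *v (z r - z q)) \<le> La * Gm * (h * Gm)"
    using abs_le_D1[OF cross[of q r]] q by auto
  moreover have "- (G q \<bullet> (P *v (z q - z s))) \<le> La * Gm * (h * Gm)"
    using abs_le_D2[OF cross[of s q]] q by auto
  ultimately show ?thesis unfolding Gm_def[symmetric] by linarith
qed

lemma V_increment:
  assumes s0: "0 \<le> s" and sr: "s \<le> r" and rh: "r \<le> s + h" and Pb: "0 \<le> Pb"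
    and past: "\<forall>q\<in>{max 0 (s-2*h)..s}. norm (z q) \<le> Pb"
  shows "V (z r) \<le> V (z s) + (r - s) * (- al * (norm (z s))\<^sup>2 + (xi * (Pb+1)\<^sup>2 + 2*C*(Pb+1)))"
proof -
  define M where "M = 2 * Pb + 1"
  define bc where "bc = - al * (norm (z s))\<^sup>2 + 2 * al * M * (h * (K * (M + 1)))
           + eta * M\<^sup>2 + C * (M + 1) + 2 * La * h * (K * (M + 1))\<^sup>2"
  have "((\<lambda>q. G q \<bullet> (P *v (z r + z s))) has_integral (z r - z s) \<bullet> (P *v (z r + z s))) {s..r}"
    using has_integral_linear[OF z_integral[OF s0 sr] bounded_linear_inner_left] by (simp add: o_def)
  moreover have "((\<lambda>q. bc) has_integral (r - s) * bc) {s..r}"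
    using has_integral_const_real[of bc s r] sr by simp
  moreover have "G q \<bullet> (P *v (z r + z s)) \<le> bc" if "q \<in> {s..r}" for q
    unfolding bc_def M_def
    by (rule integrand_bound[OF s0 sr rh _ window_extend[OF s0 sr rh Pb past] that]) (use Pb in simp)
  ultimately have "V (z r) - V (z s) \<le> (r - s) * bc"
    unfolding V_diff by (rule has_integral_le)
  moreover have "bc \<le> - al * (norm (z s))\<^sup>2 + (xi * (Pb+1)\<^sup>2 + 2*C*(Pb+1))"
  proof -
    have "- al * (norm (z s))\<^sup>2 + (xi * (Pb+1)\<^sup>2 + 2*C*(Pb+1)) - bc
        = 4 * al * h * K * (Pb + 1) + eta * (4 * Pb + 3)"
      unfolding bc_def M_def xi_def by (simp add: power2_eq_square algebra_simps)
    moreover have "0 \<le> 4 * al * h * K * (Pb + 1) + eta * (4 * Pb + 3)"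
      using al_pos h_pos K_pos eta_nonneg Pb by simp
    ultimately show ?thesis by linarith
  qed
  ultimately show ?thesis using sr by (smt (verit) mult_left_mono)
qed

lemma exp_decay_window:
  assumes "0 \<le> s - q" "s - q \<le> 2 * h"
  shows "exp (- decay_rate * q) \<le> 2 * exp (- decay_rate * s)"
proof -
  have "decay_rate * (s - q) \<le> decay_rate * (2 * h)"
    using assms decay_rate_pos by (intro mult_left_mono) auto
  moreover have "decay_rate * (2 * h) = 2 * (decay_rate * h)" by simp
  ultimately have "decay_rate * (s - q) \<le> 1/2" using decay_rate_h by linarith
  then have "norm (decay_rate * (s - q)) \<le> 1/2" using decay_rate_pos assms(1) by simp
  then have "exp (decay_rate * (s - q)) \<le> 2"
    using exp_bound_half[of "decay_rate * (s - q)"] by simp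
  moreover have "exp (- decay_rate * q) = exp (decay_rate * (s - q)) * exp (- decay_rate * s)"
    by (simp add: exp_add[symmetric] algebra_simps)
  ultimately show ?thesis by simp
qed

text \<open>Induction step of the comparison with the envelope
  \<open>Phi t = V (z 0) * exp (- decay_rate * t) + offset\<close>: the bound on \<open>[0, s]\<close> controls \<open>\<parallel>z\<parallel>\<close> on the
  window before \<open>s\<close>, hence \<open>V\<close> on \<open>[s, s + h]\<close>.\<close>
lemma V_envelope_step:
  assumes s0: "0 \<le> s" and sr: "s \<le> r" and rh: "r \<le> s + h"
    and below: "\<forall>q\<in>{0..s}. V (z q) \<le> V (z 0) * exp (- decay_rate * q) + offset"
  shows "V (z r) \<le> V (z 0) * exp (- decay_rate * r) + offset"
proof -
  define Phi where "Phi t = V (z 0) * exp (- decay_rate * t) + offset" for t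
  have Phi_s: "offset \<le> Phi s" "0 \<le> Phi s"
    using V_nonneg offset_nonneg by (simp_all add: Phi_def)
  define Pb where "Pb = sqrt (2 * Phi s / la)"
  have Pb: "0 \<le> Pb" "la * Pb\<^sup>2 = 2 * Phi s"
    unfolding Pb_def using Phi_s la_pos by simp_all
  have win: "\<forall>q\<in>{max 0 (s-2*h)..s}. norm (z q) \<le> Pb"
  proof
    fix q assume q: "q \<in> {max 0 (s-2*h)..s}"
    have "la * (norm (z q))\<^sup>2 \<le> Phi q" using V_lower[of "z q"] below q unfolding Phi_def by force
    also have "\<dots> \<le> 2 * Phi s"
    proof -
      have "V (z 0) * exp (- decay_rate * q) \<le> V (z 0) * (2 * exp (- decay_rate * s))"
        using q by (intro mult_left_mono exp_decay_window V_nonneg) auto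
      then show ?thesis using offset_nonneg unfolding Phi_def by (simp add: algebra_simps)
    qed
    finally show "norm (z q) \<le> Pb"
      using la_pos unfolding Pb_def by (intro real_le_rsqrt) (simp add: field_simps)
  qed
  have "decay_rate * (r - s) \<le> decay_rate * h" using rh decay_rate_pos by (intro mult_left_mono) auto
  then have d: "0 \<le> r - s" "decay_rate * (r - s) \<le> 1/4" using sr decay_rate_h by linarith+
  have "V (z s) \<le> Phi s" using below s0 unfolding Phi_def by auto
  then have "V (z r) \<le> (1 - decay_rate * (r - s)) * Phi s"
    by (rule envelope_step[OF V_increment[OF s0 sr rh Pb(1) win] forcing_le_decay[OF Phi_s(1) Pb]
          _ Phi_s(2) d])
  also have "\<dots> \<le> exp (- decay_rate * (r - s)) * Phi s"
    using exp_ge_add_one_self[of "- decay_rate * (r - s)"] Phi_s(2) by (intro mult_right_mono) auto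
  also have "\<dots> \<le> Phi r"
  proof -
    have "exp (- decay_rate * (r - s)) * exp (- decay_rate * s) = exp (- decay_rate * r)"
      by (simp add: exp_add[symmetric] algebra_simps)
    moreover have "exp (- decay_rate * (r - s)) * offset \<le> offset"
      using d decay_rate_pos offset_nonneg by (intro mult_left_le_one_le) auto
    ultimately show ?thesis unfolding Phi_def by (simp add: algebra_simps)
  qed
  finally show ?thesis unfolding Phi_def .
qed

theorem V_decay:
  assumes "0 \<le> t"
  shows "V (z t) \<le> V (z 0) * exp (- decay_rate * t) + offset"
proof -
  have "\<forall>q\<in>{0..real k * h}. V (z q) \<le> V (z 0) * exp (- decay_rate * q) + offset" for k :: nat
  proof (induction k)
    case 0
    then show ?case using offset_nonneg by auto
  next
    case (Suc k)
    then show ?case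
      using V_envelope_step[of "real k * h"] h_pos
      by (auto simp: algebra_simps)
  qed
  moreover obtain k :: nat where "t / h \<le> real k" using real_arch_simple by blast
  then have "t \<le> real k * h" using h_pos by (simp add: field_simps)
  ultimately show ?thesis using assms by auto
qed

lemma norm_decay:
  assumes "0 \<le> t"
  shows "norm (z t) \<le> sqrt (La / la) * norm (z 0) * exp (- (decay_rate / 2) * t) + sqrt (offset / la)"
proof -
  define Y where "Y = sqrt (La / la) * norm (z 0) * exp (- (decay_rate / 2) * t)"
  have Y0: "0 \<le> Y" unfolding Y_def using la_pos La_pos by simp
  have "exp (- decay_rate * t) = (exp (- (decay_rate / 2) * t))\<^sup>2"
    by (simp add: power2_eq_square exp_add[symmetric])
  then have Y2: "Y\<^sup>2 = La / la * (norm (z 0))\<^sup>2 * exp (- decay_rate * t)"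
    unfolding Y_def using la_pos La_pos by (simp add: power_mult_distrib)
  have "V (z 0) * exp (- decay_rate * t) \<le> La * (norm (z 0))\<^sup>2 * exp (- decay_rate * t)"
    using V_upper by (intro mult_right_mono) auto
  then have "la * (norm (z t))\<^sup>2 \<le> La * (norm (z 0))\<^sup>2 * exp (- decay_rate * t) + offset"
    using V_lower[of "z t"] V_decay[OF assms] by linarith
  then have "(norm (z t))\<^sup>2 \<le> Y\<^sup>2 + offset / la"
    unfolding Y2 using la_pos by (simp add: field_simps)
  then have "norm (z t) \<le> sqrt (Y\<^sup>2 + offset / la)" by (rule real_le_rsqrt)
  also have "\<dots> \<le> Y + sqrt (offset / la)"
    using sqrt_add_le_add_sqrt[of "Y\<^sup>2" "offset / la"] Y0 offset_nonneg la_pos by simp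
  finally show ?thesis unfolding Y_def .
qed

end

section \<open>The event-triggered closed loop\<close>

locale event_triggered_plant =
  fixes A :: "real^'nx^'nx" and B :: "real^'nu^'nx" and C :: "real^'nx^'ny"
    and Cq :: "real^'nx^'nq" and E :: "real^'np^'nx" and Ew :: "real^'nw^'nx"
    and Fw :: "real^'nw^'ny" and p :: "real^'nq \<Rightarrow> real^'np"
    and K1 :: "real^'nx^'nu" and K2 :: "real^'np^'nu"
    and L1 :: "real^'ny^'nq" and L2 :: "real^'ny^'nx"
    and P :: "real^('nx + 'nx)^('nx + 'nx)"
    and \<alpha>0 \<mu> \<omega>0 Lp :: real
  assumes p0: "p 0 = 0"
    and p_lip: "Lp-lipschitz_on UNIV p"
    and \<omega>0_pos: "\<omega>0 > 0"
    and \<alpha>0_pos: "\<alpha>0 > 0" and \<mu>_pos: "\<mu> > 0"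
    and P_sym: "transpose P = P"
    and P_pos: "\<And>z. z \<noteq> 0 \<Longrightarrow> z \<bullet> (P *v z) > 0"
    and dissip: "\<And>x xh w.
       let u = K1 *v xh + K2 *v p (Cq *v xh);
           y = C *v x + Fw *v w;
           xd = A *v x + B *v u + E *v p (Cq *v x) + Ew *v w;
           xhd = A *v xh + B *v u + E *v p (Cq *v xh + L1 *v (C *v xh - y)) + L2 *v (C *v xh - y);
           z = cat x (x - xh);
           zd = cat xd (xd - xhd)
       in zd \<bullet> (P *v z) + z \<bullet> (P *v zd) \<le> - \<alpha>0 * (z \<bullet> (P *v z)) + \<mu> * (norm w)\<^sup>2"
begin

definition m :: real where
  "m = 1 + Lp + onorm ((*v) A) + onorm ((*v) B) + onorm ((*v) C) + onorm ((*v) Cq)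
     + onorm ((*v) E) + onorm ((*v) Ew) + onorm ((*v) Fw) + onorm ((*v) K1) + onorm ((*v) K2)
     + onorm ((*v) L1) + onorm ((*v) L2) + onorm ((*v) P)"

lemma Lp_nonneg: "0 \<le> Lp"
  using p_lip by (rule lipschitz_on_nonneg)

lemma onorms_nonneg:
  "0 \<le> Lp" "0 \<le> onorm ((*v) A)" "0 \<le> onorm ((*v) B)" "0 \<le> onorm ((*v) C)" "0 \<le> onorm ((*v) Cq)"
  "0 \<le> onorm ((*v) E)" "0 \<le> onorm ((*v) Ew)" "0 \<le> onorm ((*v) Fw)" "0 \<le> onorm ((*v) K1)"
  "0 \<le> onorm ((*v) K2)" "0 \<le> onorm ((*v) L1)" "0 \<le> onorm ((*v) L2)" "0 \<le> onorm ((*v) P)"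
  by (simp_all add: Lp_nonneg onorm_matrix_nonneg)

lemma m_ge_1: "1 \<le> m"
  unfolding m_def using onorms_nonneg by linarith

lemma m_nonneg: "0 \<le> m"
  using m_ge_1 by simp

lemma operator_bounds:
  shows A_bound: "\<And>v. norm (A *v v) \<le> m * norm v" and B_bound: "\<And>v. norm (B *v v) \<le> m * norm v"
    and C_bound: "\<And>v. norm (C *v v) \<le> m * norm v" and Cq_bound: "\<And>v. norm (Cq *v v) \<le> m * norm v"
    and E_bound: "\<And>v. norm (E *v v) \<le> m * norm v" and Ew_bound: "\<And>v. norm (Ew *v v) \<le> m * norm v"
    and Fw_bound: "\<And>v. norm (Fw *v v) \<le> m * norm v" and K1_bound: "\<And>v. norm (K1 *v v) \<le> m * norm v"
    and K2_bound: "\<And>v. norm (K2 *v v) \<le> m * norm v" and L1_bound: "\<And>v. norm (L1 *v v) \<le> m * norm v"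
    and L2_bound: "\<And>v. norm (L2 *v v) \<le> m * norm v" and P_bound: "\<And>v. norm (P *v v) \<le> m * norm v"
  by (rule norm_matrix_vector_le; use onorms_nonneg in \<open>unfold m_def; linarith\<close>)+

lemma p_lipschitz: "norm (p a - p b) \<le> m * norm (a - b)"
proof -
  have "norm (p a - p b) \<le> Lp * norm (a - b)"
    using lipschitz_onD[OF p_lip, of a b] by (simp add: dist_norm)
  also have "\<dots> \<le> m * norm (a - b)"
    using onorms_nonneg by (intro mult_right_mono) (auto simp: m_def)
  finally show ?thesis .
qed

definition la :: real where
  "la = (SOME l. 0 < l \<and> (\<forall>v. l * (norm v)\<^sup>2 \<le> v \<bullet> (P *v v)))"

lemma la_pos: "0 < la" and quad_lower: "la * (norm v)\<^sup>2 \<le> v \<bullet> (P *v v)"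
  using someI_ex[OF posdef_quadratic_form_coercive[OF P_pos]] unfolding la_def by auto

lemma P_commute: "a \<bullet> (P *v b) = b \<bullet> (P *v a)"
  by (rule symmetric_matrix_inner_commute[OF P_sym])

lemma quad_upper: "\<bar>a \<bullet> (P *v b)\<bar> \<le> m * norm a * norm b"
proof -
  have "\<bar>a \<bullet> (P *v b)\<bar> \<le> norm a * norm (P *v b)" by (rule Cauchy_Schwarz_ineq2)
  also have "\<dots> \<le> norm a * (m * norm b)" by (intro mult_left_mono P_bound) auto
  finally show ?thesis by (simp add: algebra_simps)
qed

definition ctrl :: "real^'nx \<Rightarrow> real^'nu" where
  "ctrl xs = K1 *v xs + K2 *v p (Cq *v xs)"

definition outp :: "real^'nx \<Rightarrow> real^'nw \<Rightarrow> real^'ny" where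
  "outp x w = C *v x + Fw *v w"

definition plant_field :: "real^'nx \<Rightarrow> real^'nu \<Rightarrow> real^'nw \<Rightarrow> real^'nx" where
  "plant_field x u w = A *v x + B *v u + E *v p (Cq *v x) + Ew *v w"

definition observer_field :: "real^'nx \<Rightarrow> real^'nu \<Rightarrow> real^'ny \<Rightarrow> real^'nx" where
  "observer_field xh u ym = A *v xh + B *v u + E *v p (Cq *v xh + L1 *v (C *v xh - ym))
     + L2 *v (C *v xh - ym)"

text \<open>Right-hand side for \<open>z = (x, x - xh)\<close> when the controller uses the held estimate \<open>xs\<close>
  and the observer the held output \<open>ym\<close>.\<close>
definition error_field ::
    "real^'nx \<Rightarrow> real^'nx \<Rightarrow> real^'nx \<Rightarrow> real^'ny \<Rightarrow> real^'nw \<Rightarrow> real^('nx + 'nx)" where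
  "error_field x xh xs ym w = cat (plant_field x (ctrl xs) w)
     (plant_field x (ctrl xs) w - observer_field xh (ctrl xs) ym)"

lemma nominal_dissipation:
  "2 * (error_field x xh xh (outp x w) w \<bullet> (P *v cat x (x - xh)))
     \<le> - \<alpha>0 * (cat x (x - xh) \<bullet> (P *v cat x (x - xh))) + \<mu> * (norm w)\<^sup>2"
proof -
  define zd where "zd = error_field x xh xh (outp x w) w"
  have "zd \<bullet> (P *v cat x (x - xh)) + cat x (x - xh) \<bullet> (P *v zd)
      \<le> - \<alpha>0 * (cat x (x - xh) \<bullet> (P *v cat x (x - xh))) + \<mu> * (norm w)\<^sup>2"
    using dissip[of xh x w]
    unfolding Let_def zd_def error_field_def plant_field_def observer_field_def ctrl_def outp_def .
  then show ?thesis unfolding zd_def[symmetric] P_commute[of "cat x (x - xh)" zd] by simp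
qed

lemma p_diff_le: "norm (a - b) \<le> d \<Longrightarrow> norm (p a - p b) \<le> m * d"
  using p_lipschitz[of a b] mult_left_mono[OF _ m_nonneg] by (meson order_trans)

lemma ctrl_lipschitz:
  assumes "norm (xs - xs') \<le> d"
  shows "norm (ctrl xs - ctrl xs') \<le> (m + m^3) * d"
proof -
  have "norm (Cq *v xs - Cq *v xs') \<le> m * d"
    using norm_matrix_vector_diff_le[OF Cq_bound m_nonneg assms] .
  then have "norm (p (Cq *v xs) - p (Cq *v xs')) \<le> m * (m * d)" by (rule p_diff_le)
  then have "norm ((K1 *v xs - K1 *v xs') + (K2 *v p (Cq *v xs) - K2 *v p (Cq *v xs')))
      \<le> m * d + m * (m * (m * d))"
    by (intro norm_add_le_bounds norm_matrix_vector_diff_le[OF K1_bound m_nonneg assms]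
        norm_matrix_vector_diff_le[OF K2_bound m_nonneg])
  then have "norm (ctrl xs - ctrl xs') \<le> m * d + m * (m * (m * d))"
    unfolding ctrl_def by (simp add: algebra_simps)
  then show ?thesis by (simp add: algebra_simps power3_eq_cube)
qed

lemma plant_field_lipschitz:
  assumes x: "norm (x - x') \<le> d" and u: "norm (u - u') \<le> e" and w: "norm (w - w') \<le> d"
  shows "norm (plant_field x u w - plant_field x' u' w') \<le> (2*m + m^3) * d + m * e"
proof -
  have "norm (p (Cq *v x) - p (Cq *v x')) \<le> m * (m * d)"
    by (rule p_diff_le[OF norm_matrix_vector_diff_le[OF Cq_bound m_nonneg x]])
  then have "norm ((A *v x - A *v x') + (B *v u - B *v u')
        + (E *v p (Cq *v x) - E *v p (Cq *v x')) + (Ew *v w - Ew *v w'))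
      \<le> m * d + m * e + m * (m * (m * d)) + m * d"
    by (intro norm_add_le_bounds norm_matrix_vector_diff_le[OF A_bound m_nonneg x]
        norm_matrix_vector_diff_le[OF B_bound m_nonneg u] norm_matrix_vector_diff_le[OF E_bound m_nonneg]
        norm_matrix_vector_diff_le[OF Ew_bound m_nonneg w])
  then show ?thesis unfolding plant_field_def by (simp add: algebra_simps power3_eq_cube)
qed

lemma observer_field_lipschitz:
  assumes xh: "norm (xh - xh') \<le> d" and u: "norm (u - u') \<le> e" and ym: "norm (ym - ym') \<le> d"
  shows "norm (observer_field xh u ym - observer_field xh' u' ym')
    \<le> (2*m + m^2 + 2*m^3 + m^4) * d + m * e"
proof -
  have v: "norm ((C *v xh - ym) - (C *v xh' - ym')) \<le> m * d + d"
    using norm_diff_le_bounds[OF norm_matrix_vector_diff_le[OF C_bound m_nonneg xh] ym]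
    by (simp add: algebra_simps)
  have "norm ((Cq *v xh + L1 *v (C *v xh - ym)) - (Cq *v xh' + L1 *v (C *v xh' - ym')))
      \<le> m * d + m * (m * d + d)"
    using norm_add_le_bounds[OF norm_matrix_vector_diff_le[OF Cq_bound m_nonneg xh]
        norm_matrix_vector_diff_le[OF L1_bound m_nonneg v]]
    by (simp add: algebra_simps)
  then have "norm (p (Cq *v xh + L1 *v (C *v xh - ym)) - p (Cq *v xh' + L1 *v (C *v xh' - ym')))
      \<le> m * (m * d + m * (m * d + d))" by (rule p_diff_le)
  then have "norm ((A *v xh - A *v xh') + (B *v u - B *v u')
        + (E *v p (Cq *v xh + L1 *v (C *v xh - ym)) - E *v p (Cq *v xh' + L1 *v (C *v xh' - ym')))
        + (L2 *v (C *v xh - ym) - L2 *v (C *v xh' - ym')))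
      \<le> m * d + m * e + m * (m * (m * d + m * (m * d + d))) + m * (m * d + d)"
    by (intro norm_add_le_bounds norm_matrix_vector_diff_le[OF A_bound m_nonneg xh]
        norm_matrix_vector_diff_le[OF B_bound m_nonneg u] norm_matrix_vector_diff_le[OF E_bound m_nonneg]
        norm_matrix_vector_diff_le[OF L2_bound m_nonneg v])
  then show ?thesis
    unfolding observer_field_def by (simp add: algebra_simps power3_eq_cube power4_eq_xxxx power2_eq_square)
qed

definition Lf :: real where "Lf = 6*m + 4*m^2 + 4*m^3 + 4*m^4"

lemma Lf_nonneg: "0 \<le> Lf"
  unfolding Lf_def using m_nonneg by simp

lemma error_field_lipschitz:
  assumes "norm (x - x') \<le> d" "norm (xh - xh') \<le> d" "norm (xs - xs') \<le> d"
    and "norm (ym - ym') \<le> d" "norm (w - w') \<le> d"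
  shows "norm (error_field x xh xs ym w - error_field x' xh' xs' ym' w') \<le> Lf * d"
proof -
  define dp where "dp = plant_field x (ctrl xs) w - plant_field x' (ctrl xs') w'"
  define dob where "dob = observer_field xh (ctrl xs) ym - observer_field xh' (ctrl xs') ym'"
  have u: "norm (ctrl xs - ctrl xs') \<le> (m + m^3) * d" by (rule ctrl_lipschitz[OF assms(3)])
  have "norm dp \<le> (2*m + m^3) * d + m * ((m + m^3) * d)"
    unfolding dp_def by (rule plant_field_lipschitz[OF assms(1) u assms(5)])
  moreover have "norm dob \<le> (2*m + m^2 + 2*m^3 + m^4) * d + m * ((m + m^3) * d)"
    unfolding dob_def by (rule observer_field_lipschitz[OF assms(2) u assms(4)])
  moreover have "error_field x xh xs ym w - error_field x' xh' xs' ym' w' = cat dp (dp - dob)"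
    unfolding error_field_def dp_def dob_def by (simp add: cat_diff[symmetric] algebra_simps)
  ultimately have "norm (error_field x xh xs ym w - error_field x' xh' xs' ym' w')
      \<le> norm dp + (norm dp + norm dob)"
    using norm_cat_le[of dp "dp - dob"] norm_triangle_ineq4[of dp dob] by simp
  also have "\<dots> \<le> ((2*m + m^3) * d + m * ((m + m^3) * d))
        + (((2*m + m^3) * d + m * ((m + m^3) * d)) + ((2*m + m^2 + 2*m^3 + m^4) * d + m * ((m + m^3) * d)))"
    using \<open>norm dp \<le> _\<close> \<open>norm dob \<le> _\<close> by linarith
  finally show ?thesis
    unfolding Lf_def by (simp add: algebra_simps power3_eq_cube power4_eq_xxxx power2_eq_square)
qed

lemma error_field_bound:
  assumes "norm x \<le> d" "norm xh \<le> d" "norm xs \<le> d" "norm ym \<le> d" "norm w \<le> d"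
  shows "norm (error_field x xh xs ym w) \<le> Lf * d"
proof -
  have "error_field 0 0 0 0 0 = 0"
    unfolding error_field_def plant_field_def observer_field_def ctrl_def
    by (simp add: p0 vec_eq_iff cat_def split: sum.splits)
  then show ?thesis using error_field_lipschitz[of x 0 d xh 0 xs 0 ym 0 w 0] assms by simp
qed

definition Kv :: real where "Kv = Lf * (4 + 2*m + 2*m*\<omega>0 + \<omega>0)"

definition eta :: "real \<Rightarrow> real \<Rightarrow> real" where
  "eta \<sigma> h = 2 * m * Lf * (2 + m) * (\<sigma> + h * Kv)"

definition Cv :: real where
  "Cv = 2 * m * Lf * (Kv * (2 + m) + 2 + 3 * m * \<omega>0) + \<mu> * \<omega>0\<^sup>2"

lemma Lf_pos: "0 < Lf"
  unfolding Lf_def using m_ge_1 zero_le_power[OF m_nonneg, of 2] zero_le_power[OF m_nonneg, of 3]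
    zero_le_power[OF m_nonneg, of 4] by linarith

lemma Kv_pos: "0 < Kv"
  unfolding Kv_def using Lf_pos m_nonneg \<omega>0_pos
  by (intro mult_pos_pos) (auto intro!: add_pos_nonneg)

lemma Cv_nonneg: "0 \<le> Cv"
  unfolding Cv_def using Lf_pos Kv_pos m_nonneg \<omega>0_pos \<mu>_pos by simp

lemma sampling_perturbation_le:
  assumes M0: "0 \<le> M" and h: "0 \<le> h" "h \<le> 1"
  shows "2 * (m * Lf * ((\<sigma> * (2 + m) * M + h * Kv * (2 + m) * (M + 1) + (2 + 3 * m * \<omega>0)) * M))
    \<le> eta \<sigma> h * M\<^sup>2 + (Cv - \<mu> * \<omega>0\<^sup>2) * (M + 1)"
proof -
  have "h * (Kv * (2 + m) * M) \<le> Kv * (2 + m) * (M + 1)"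
    using mult_right_mono[OF h(2), of "Kv * (2 + m) * M"] Kv_pos m_nonneg M0
    by (smt (verit) mult_nonneg_nonneg mult_left_mono)
  moreover have "(2 + 3 * m * \<omega>0) * M \<le> (2 + 3 * m * \<omega>0) * (M + 1)"
    using m_nonneg \<omega>0_pos by (intro mult_left_mono) auto
  ultimately have "h * Kv * (2 + m) * M + (2 + 3 * m * \<omega>0) * M \<le> (Kv * (2 + m) + 2 + 3 * m * \<omega>0) * (M + 1)"
    by (simp add: algebra_simps)
  then have "2 * (m * Lf) * (h * Kv * (2 + m) * M + (2 + 3 * m * \<omega>0) * M)
      \<le> 2 * (m * Lf) * ((Kv * (2 + m) + 2 + 3 * m * \<omega>0) * (M + 1))"
    using m_nonneg Lf_nonneg by (intro mult_left_mono) auto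
  then show ?thesis unfolding eta_def Cv_def by (simp add: power2_eq_square algebra_simps)
qed

end

locale et_trajectory = event_triggered_plant A B C Cq E Ew Fw p K1 K2 L1 L2 P \<alpha>0 \<mu> \<omega>0 Lp
  for A :: "real^'nx^'nx" and B :: "real^'nu^'nx" and C :: "real^'nx^'ny"
    and Cq :: "real^'nx^'nq" and E :: "real^'np^'nx" and Ew :: "real^'nw^'nx"
    and Fw :: "real^'nw^'ny" and p :: "real^'nq \<Rightarrow> real^'np"
    and K1 :: "real^'nx^'nu" and K2 :: "real^'np^'nu"
    and L1 :: "real^'ny^'nq" and L2 :: "real^'ny^'nx"
    and P :: "real^('nx + 'nx)^('nx + 'nx)"
    and \<alpha>0 \<mu> \<omega>0 Lp :: real +
  fixes h \<sigma> :: real and x xh :: "real \<Rightarrow> real^'nx" and w :: "real \<Rightarrow> real^'nw"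
    and ty tu :: "nat \<Rightarrow> ereal" and ys :: "real \<Rightarrow> real^'ny" and xhs :: "real \<Rightarrow> real^'nx"
  assumes h_pos: "0 < h" and h_le_1: "h \<le> 1" and \<sigma>_pos: "0 < \<sigma>" and \<sigma>_le_1: "\<sigma> \<le> 1"
    and w_bound: "\<And>t. 0 \<le> t \<Longrightarrow> norm (w t) \<le> \<omega>0"
    and trig_y: "trig h \<sigma> 1 (\<lambda>t. outp (x t) (w t)) ty"
    and held_y: "held ty (\<lambda>t. outp (x t) (w t)) ys"
    and trig_u: "trig h \<sigma> 1 xh tu" and held_u: "held tu xh xhs"
    and x_integral: "\<And>t. 0 \<le> t \<Longrightarrow>
      ((\<lambda>s. plant_field (x s) (ctrl (xhs s)) (w s)) has_integral (x t - x 0)) {0..t}"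
    and xh_integral: "\<And>t. 0 \<le> t \<Longrightarrow>
      ((\<lambda>s. observer_field (xh s) (ctrl (xhs s)) (ys s)) has_integral (xh t - xh 0)) {0..t}"
begin

definition z :: "real \<Rightarrow> real^('nx + 'nx)" where "z t = cat (x t) (x t - xh t)"

definition G :: "real \<Rightarrow> real^('nx + 'nx)" where
  "G s = error_field (x s) (xh s) (xhs s) (ys s) (w s)"

lemma z_integral: "0 \<le> s \<Longrightarrow> s \<le> t \<Longrightarrow> (G has_integral (z t - z s)) {s..t}"
proof -
  assume st: "0 \<le> s" "s \<le> t"
  have "((\<lambda>s. plant_field (x s) (ctrl (xhs s)) (w s)) has_integral (x t - x s)) {s..t}"
    by (rule has_integral_from_zero_on_subinterval[OF x_integral st])
  moreover have "((\<lambda>s. observer_field (xh s) (ctrl (xhs s)) (ys s)) has_integral (xh t - xh s)) {s..t}"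
    by (rule has_integral_from_zero_on_subinterval[OF xh_integral st])
  ultimately have "(G has_integral cat (x t - x s) ((x t - x s) - (xh t - xh s))) {s..t}"
    unfolding G_def error_field_def by (intro has_integral_cat has_integral_diff)
  then show ?thesis unfolding z_def by (simp add: cat_diff[symmetric] algebra_simps)
qed

lemma norm_x_le_z: "norm (x q) \<le> norm (z q)"
  unfolding z_def by (rule norm_cat_ge_left)

lemma norm_xh_le_z: "norm (xh q) \<le> 2 * norm (z q)"
  unfolding z_def by (rule norm_le_twice_norm_cat_diff)

lemma output_bound: "0 \<le> q \<Longrightarrow> norm (outp (x q) (w q)) \<le> m * norm (x q) + m * \<omega>0"
  unfolding outp_def
  by (intro norm_add_le_bounds C_bound order_trans[OF Fw_bound] mult_left_mono w_bound m_nonneg)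

lemma held_estimate_bound:
  assumes r0: "0 \<le> r" and win: "\<forall>q\<in>{max 0 (r-h)..r}. norm (z q) \<le> M"
  shows "norm (xhs r) \<le> 4 * M + 1"
proof -
  obtain t0 where t0: "0 \<le> t0" "t0 \<le> r" "xhs r = xh t0"
      "r < t0 + h \<or> norm (xh t0 - xh r) \<le> \<sigma> * norm (xh r) + 1"
    using held_sample_time[OF trig_u held_u h_pos r0] by blast
  have "norm (z r) \<le> M" using win r0 h_pos by auto
  then have r: "norm (xh r) \<le> 2 * M" "0 \<le> M" using norm_xh_le_z[of r] norm_ge_zero[of "z r"] by linarith+
  show ?thesis
  proof (cases "r < t0 + h")
    case True
    then have "norm (z t0) \<le> M" using win t0 by auto
    then show ?thesis unfolding t0(3) using norm_xh_le_z[of t0] r(2) by linarith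
  next
    case False
    then have "norm (xh t0) \<le> norm (xh r) + (\<sigma> * norm (xh r) + 1)"
      using t0(4) norm_triangle_sub[of "xh t0" "xh r"] by linarith
    moreover have "\<sigma> * norm (xh r) \<le> norm (xh r)" using mult_right_mono[OF \<sigma>_le_1 norm_ge_zero] by simp
    ultimately show ?thesis unfolding t0(3) using r(1) by linarith
  qed
qed

lemma held_output_bound:
  assumes r0: "0 \<le> r" and win: "\<forall>q\<in>{max 0 (r-h)..r}. norm (z q) \<le> M"
  shows "norm (ys r) \<le> 2 * m * M + 2 * m * \<omega>0 + 1"
proof -
  obtain t1 where t1: "0 \<le> t1" "t1 \<le> r" "ys r = outp (x t1) (w t1)"
      "r < t1 + h \<or> norm (outp (x t1) (w t1) - outp (x r) (w r)) \<le> \<sigma> * norm (outp (x r) (w r)) + 1"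
    using held_sample_time[OF trig_y held_y h_pos r0] by blast
  have y: "norm (outp (x q) (w q)) \<le> m * M + m * \<omega>0" if "q \<in> {max 0 (r-h)..r}" for q
  proof -
    have "m * norm (x q) \<le> m * M"
      using win that norm_x_le_z[of q] m_nonneg by (intro mult_left_mono) force+
    then show ?thesis using output_bound[of q] that by auto
  qed
  have "norm (z r) \<le> M" using win r0 h_pos by auto
  then have M0: "0 \<le> M" by (meson norm_ge_zero order_trans)
  show ?thesis
  proof (cases "r < t1 + h")
    case True
    then have "norm (ys r) \<le> m * M + m * \<omega>0" using y[of t1] t1 by auto
    moreover have "0 \<le> m * M" "0 \<le> m * \<omega>0" using m_nonneg M0 \<omega>0_pos by simp_all
    ultimately show ?thesis by linarith
  next
    case False
    have yr: "norm (outp (x r) (w r)) \<le> m * M + m * \<omega>0" using y r0 h_pos by auto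
    have "norm (outp (x t1) (w t1) - outp (x r) (w r)) \<le> \<sigma> * norm (outp (x r) (w r)) + 1"
      using t1(4) False by blast
    then have "norm (ys r) \<le> norm (outp (x r) (w r)) + (\<sigma> * norm (outp (x r) (w r)) + 1)"
      unfolding t1(3) using norm_triangle_sub[of "outp (x t1) (w t1)" "outp (x r) (w r)"] by linarith
    moreover have "\<sigma> * norm (outp (x r) (w r)) \<le> norm (outp (x r) (w r))"
      using mult_right_mono[OF \<sigma>_le_1 norm_ge_zero] by simp
    ultimately show ?thesis using yr by linarith
  qed
qed

lemma G_bound:
  assumes r0: "0 \<le> r" and win: "\<forall>q\<in>{max 0 (r-h)..r}. norm (z q) \<le> M"
  shows "norm (G r) \<le> Kv * (M + 1)"
proof -
  define D where "D = 4 + 2*m + 2*m*\<omega>0 + \<omega>0"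
  have zr: "norm (z r) \<le> M" using win r0 h_pos by auto
  then have M0: "0 \<le> M" by (meson norm_ge_zero order_trans)
  have mw: "0 \<le> m * \<omega>0" using m_nonneg \<omega>0_pos by simp
  have "norm (G r) \<le> Lf * (D * (M + 1))"
    unfolding G_def
  proof (rule error_field_bound)
    show "norm (x r) \<le> D * (M + 1)"
      using norm_x_le_z[of r] zr affine_le_linear_bound[OF M0, of 1 D 0] mw m_nonneg \<omega>0_pos
      unfolding D_def by auto
    show "norm (xh r) \<le> D * (M + 1)"
      using norm_xh_le_z[of r] zr affine_le_linear_bound[OF M0, of 2 D 0] mw m_nonneg \<omega>0_pos
      unfolding D_def by auto
    show "norm (xhs r) \<le> D * (M + 1)"
      using held_estimate_bound[OF r0 win] affine_le_linear_bound[OF M0, of 4 D 1] mw m_nonneg \<omega>0_pos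
      unfolding D_def by auto
    show "norm (ys r) \<le> D * (M + 1)"
      using held_output_bound[OF r0 win] affine_le_linear_bound[OF M0, of "2 * m" D "2 * m * \<omega>0 + 1"]
        mw m_nonneg \<omega>0_pos
      unfolding D_def by (auto simp: algebra_simps)
    show "norm (w r) \<le> D * (M + 1)"
      using w_bound[OF r0] affine_le_linear_bound[OF M0, of 0 D \<omega>0] mw m_nonneg \<omega>0_pos
      unfolding D_def by auto
  qed
  then show ?thesis unfolding Kv_def D_def by (simp add: mult.assoc)
qed

lemma z_dwell_variation:
  assumes t0: "0 \<le> t0" "t0 \<le> r" "r < t0 + h"
    and win: "\<forall>q\<in>{max 0 (r-2*h)..r}. norm (z q) \<le> M"
  shows "norm (z r - z t0) \<le> h * (Kv * (M + 1))"
proof -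
  have "norm (z r) \<le> M" using win t0 h_pos by auto
  then have K0: "0 \<le> Kv * (M + 1)" using Kv_pos by (simp add: add_nonneg_nonneg order_trans[OF norm_ge_zero])
  have "norm (G q) \<le> Kv * (M + 1)" if "q \<in> {t0..r}" for q
    by (rule G_bound) (use that t0 win in auto)
  then have "norm (z r - z t0) \<le> Kv * (M + 1) * (r - t0)"
    using has_integral_bound[OF K0 z_integral[OF t0(1,2), folded cbox_interval]] t0(2)
    by (auto simp: cbox_interval)
  also have "\<dots> \<le> Kv * (M + 1) * h" using t0 K0 by (intro mult_left_mono) auto
  finally show ?thesis by (simp add: mult.commute)
qed

lemma held_estimate_error:
  assumes r0: "0 \<le> r" and win: "\<forall>q\<in>{max 0 (r-2*h)..r}. norm (z q) \<le> M"
  shows "norm (xhs r - xh r) \<le> 2 * \<sigma> * M + 1 + 2 * (h * (Kv * (M + 1)))"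
proof -
  obtain t0 where t0: "0 \<le> t0" "t0 \<le> r" "xhs r = xh t0"
      "r < t0 + h \<or> norm (xh t0 - xh r) \<le> \<sigma> * norm (xh r) + 1"
    using held_sample_time[OF trig_u held_u h_pos r0] by blast
  have "norm (z r) \<le> M" using win r0 h_pos by auto
  then have xhr: "norm (xh r) \<le> 2 * M" and M0: "0 \<le> M"
    using norm_xh_le_z[of r] norm_ge_zero[of "z r"] by linarith+
  have hK: "0 \<le> h * (Kv * (M + 1))" using h_pos Kv_pos M0 by simp
  show ?thesis
  proof (cases "r < t0 + h")
    case True
    have "z t0 - z r = cat (x t0 - x r) ((x t0 - x r) - (xh t0 - xh r))"
      unfolding z_def by (simp add: cat_diff[symmetric] algebra_simps)
    then have "norm (xh t0 - xh r) \<le> 2 * norm (z t0 - z r)" by (simp add: norm_le_twice_norm_cat_diff)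
    then have "norm (xh t0 - xh r) \<le> 2 * norm (z r - z t0)" by (simp add: norm_minus_commute)
    moreover have "0 \<le> 2 * \<sigma> * M" using \<sigma>_pos M0 by simp
    ultimately show ?thesis unfolding t0(3) using z_dwell_variation[OF t0(1,2) True win] by linarith
  next
    case False
    then have "norm (xh t0 - xh r) \<le> \<sigma> * norm (xh r) + 1" using t0(4) by blast
    moreover have "\<sigma> * norm (xh r) \<le> \<sigma> * (2 * M)" using xhr \<sigma>_pos by (intro mult_left_mono) auto
    ultimately show ?thesis unfolding t0(3) using hK by simp
  qed
qed

lemma held_output_error:
  assumes r0: "0 \<le> r" and win: "\<forall>q\<in>{max 0 (r-2*h)..r}. norm (z q) \<le> M"
  shows "norm (ys r - outp (x r) (w r)) \<le> \<sigma> * m * M + 1 + m * (h * (Kv * (M + 1))) + 3 * m * \<omega>0"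
proof -
  obtain t1 where t1: "0 \<le> t1" "t1 \<le> r" "ys r = outp (x t1) (w t1)"
      "r < t1 + h \<or> norm (outp (x t1) (w t1) - outp (x r) (w r)) \<le> \<sigma> * norm (outp (x r) (w r)) + 1"
    using held_sample_time[OF trig_y held_y h_pos r0] by blast
  have "norm (z r) \<le> M" using win r0 h_pos by auto
  then have xr: "norm (x r) \<le> M" and M0: "0 \<le> M"
    using norm_x_le_z[of r] norm_ge_zero[of "z r"] by linarith+
  have nn: "0 \<le> \<sigma> * m * M" "0 \<le> m * \<omega>0" "0 \<le> m * (h * (Kv * (M + 1)))"
    using \<sigma>_pos m_nonneg M0 \<omega>0_pos h_pos Kv_pos by simp_all
  show ?thesis
  proof (cases "r < t1 + h")
    case True
    have "z r - z t1 = cat (x r - x t1) ((x r - xh r) - (x t1 - xh t1))"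
      unfolding z_def by (simp add: cat_diff[symmetric])
    then have "norm (x r - x t1) \<le> norm (z r - z t1)" by (simp add: norm_cat_ge_left)
    then have "norm (x t1 - x r) \<le> h * (Kv * (M + 1))"
      using z_dwell_variation[OF t1(1,2) True win] norm_minus_commute[of "x t1" "x r"] by linarith
    moreover have "norm (w t1 - w r) \<le> \<omega>0 + \<omega>0"
      by (rule norm_diff_le_bounds) (use w_bound t1 r0 in auto)
    ultimately have "norm ((C *v x t1 - C *v x r) + (Fw *v w t1 - Fw *v w r))
        \<le> m * (h * (Kv * (M + 1))) + m * (\<omega>0 + \<omega>0)"
      by (intro norm_add_le_bounds norm_matrix_vector_diff_le[OF C_bound m_nonneg]
          norm_matrix_vector_diff_le[OF Fw_bound m_nonneg])
    then have "norm (outp (x t1) (w t1) - outp (x r) (w r)) \<le> m * (h * (Kv * (M + 1))) + m * (\<omega>0 + \<omega>0)"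
      unfolding outp_def by (simp add: algebra_simps)
    then show ?thesis unfolding t1(3) using nn by (simp add: algebra_simps)
  next
    case False
    then have "norm (outp (x t1) (w t1) - outp (x r) (w r)) \<le> \<sigma> * norm (outp (x r) (w r)) + 1"
      using t1(4) by blast
    moreover have "m * norm (x r) \<le> m * M" using xr m_nonneg by (rule mult_left_mono)
    then have "\<sigma> * norm (outp (x r) (w r)) \<le> \<sigma> * (m * M + m * \<omega>0)"
      using output_bound[OF r0] \<sigma>_pos by (intro mult_left_mono) auto
    moreover have "\<sigma> * (m * \<omega>0) \<le> m * \<omega>0" using mult_right_mono[OF \<sigma>_le_1 nn(2)] by simp
    ultimately show ?thesis unfolding t1(3) using nn by (simp add: norm_minus_commute algebra_simps)
  qed
qed

lemma nominal_dissipation_bound: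
  assumes "0 \<le> r" "0 \<le> M"
  shows "2 * (error_field (x r) (xh r) (xh r) (outp (x r) (w r)) (w r) \<bullet> (P *v z r))
    \<le> - (\<alpha>0 * la) * (norm (z r))\<^sup>2 + \<mu> * \<omega>0\<^sup>2 * (M + 1)"
proof -
  have "\<alpha>0 * (la * (norm (z r))\<^sup>2) \<le> \<alpha>0 * (z r \<bullet> (P *v z r))"
    using quad_lower \<alpha>0_pos by (intro mult_left_mono) auto
  moreover have "\<mu> * (norm (w r))\<^sup>2 \<le> \<mu> * \<omega>0\<^sup>2"
    using w_bound[OF assms(1)] \<mu>_pos by (intro mult_left_mono power_mono) auto
  moreover have "\<mu> * \<omega>0\<^sup>2 \<le> \<mu> * \<omega>0\<^sup>2 * (M + 1)"
    using mult_left_mono[of 1 "M + 1" "\<mu> * \<omega>0\<^sup>2"] assms(2) \<mu>_pos by simp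
  ultimately show ?thesis
    using nominal_dissipation[of "x r" "xh r" "w r"] unfolding z_def[symmetric] by simp
qed

text \<open>The held signals perturb the nominal dissipation inequality by a term linear in the
  sampling errors, which are small relative to \<open>M\<close> (factor \<open>\<sigma> + h\<close>) up to a constant.\<close>
lemma G_dissipation:
  assumes r0: "0 \<le> r" and win: "\<forall>q\<in>{max 0 (r-2*h)..r}. norm (z q) \<le> M"
  shows "2 * (G r \<bullet> (P *v z r)) \<le> - (\<alpha>0 * la) * (norm (z r))\<^sup>2 + eta \<sigma> h * M\<^sup>2 + Cv * (M + 1)"
proof -
  have zr: "norm (z r) \<le> M" using win r0 h_pos by auto
  then have M0: "0 \<le> M" by (meson norm_ge_zero order_trans)
  define G0 where "G0 = error_field (x r) (xh r) (xh r) (outp (x r) (w r)) (w r)"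
  define S where "S = norm (xhs r - xh r) + norm (ys r - outp (x r) (w r))"
  have "norm (G r - G0) \<le> Lf * S"
    unfolding G_def G0_def S_def by (rule error_field_lipschitz) auto
  then have "2 * ((G r - G0) \<bullet> (P *v z r)) \<le> 2 * (m * Lf * S * norm (z r))"
    using norm_cauchy_schwarz[of "G r - G0" "P *v z r"] P_bound[of "z r"] Lf_nonneg m_nonneg
    by (smt (verit, best) mult.commute mult.left_commute mult_mono norm_ge_zero)
  also have "\<dots> \<le> 2 * (m * Lf * ((\<sigma> * (2 + m) * M + h * Kv * (2 + m) * (M + 1) + (2 + 3 * m * \<omega>0)) * M))"
  proof -
    have "S \<le> \<sigma> * (2 + m) * M + h * Kv * (2 + m) * (M + 1) + (2 + 3 * m * \<omega>0)"
      using held_estimate_error[OF r0 win] held_output_error[OF r0 win]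
      unfolding S_def by (simp add: algebra_simps)
    moreover have "0 \<le> S" unfolding S_def by simp
    ultimately have "S * norm (z r) \<le> (\<sigma> * (2 + m) * M + h * Kv * (2 + m) * (M + 1) + (2 + 3 * m * \<omega>0)) * M"
      using zr by (intro mult_mono) auto
    then show ?thesis using Lf_nonneg m_nonneg by (simp add: mult.assoc mult_left_mono)
  qed
  also have "\<dots> \<le> eta \<sigma> h * M\<^sup>2 + (Cv - \<mu> * \<omega>0\<^sup>2) * (M + 1)"
    by (rule sampling_perturbation_le[OF M0 less_imp_le[OF h_pos] h_le_1])
  finally show ?thesis
    using nominal_dissipation_bound[OF r0 M0] unfolding G0_def[symmetric]
    by (simp add: inner_diff_left algebra_simps)
qed

end

lemma small_window_parameters:
  fixes al la La K D :: real
  assumes al: "0 < al" and la: "0 < la" and La: "0 < La" and K: "0 < K" and D: "0 \<le> D"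
  obtains h \<sigma> where "0 < h" "h \<le> 1" "0 < \<sigma>" "\<sigma> \<le> 1" "h * K \<le> 1/4" "h * al \<le> La"
    "64 * La * (8*al*h*K + D * (\<sigma> + h * K) + 8*La*h*K\<^sup>2) \<le> al * la"
proof -
  define X where "X = al * la / (64 * La)"
  define Q where "Q = 8*al*K + D*K + 8*La*K\<^sup>2"
  define \<sigma> where "\<sigma> = min 1 (X / (2 * (D + 1)))"
  define h where "h = min (min 1 (1 / (4*K))) (min (La/al) (X / (2*(Q + 1))))"
  have X: "0 < X" unfolding X_def using al la La by simp
  have Q: "0 \<le> Q" unfolding Q_def using al K D La by simp
  have \<sigma>: "0 < \<sigma>" "\<sigma> \<le> 1" unfolding \<sigma>_def using X D by auto
  have h: "0 < h" "h \<le> 1" unfolding h_def using K La al X Q by auto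
  have "h * K \<le> 1 / (4*K) * K" unfolding h_def using K by (intro mult_right_mono) auto
  then have hK: "h * K \<le> 1/4" using K by simp
  have "h * al \<le> La / al * al" unfolding h_def using al by (intro mult_right_mono) auto
  then have hal: "h * al \<le> La" using al by simp
  have "h * (Q + 1) \<le> X / (2*(Q + 1)) * (Q + 1)" unfolding h_def using Q by (intro mult_right_mono) auto
  also have "\<dots> = X / 2" using Q by (simp add: field_simps)
  finally have "h * Q + h \<le> X / 2" by (simp add: distrib_left)
  then have hQ: "h * Q \<le> X / 2" using h(1) by linarith
  have "D * \<sigma> \<le> D * (X / (2 * (D + 1)))" unfolding \<sigma>_def using D by (intro mult_left_mono) auto
  also have "\<dots> \<le> X / 2" using D X by (simp add: field_simps)
  finally have "8*al*h*K + D * (\<sigma> + h * K) + 8*La*h*K\<^sup>2 \<le> X"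
    using hQ unfolding Q_def by (simp add: algebra_simps)
  then have "64 * La * (8*al*h*K + D * (\<sigma> + h * K) + 8*La*h*K\<^sup>2) \<le> 64 * La * X"
    using La by (intro mult_left_mono) auto
  also have "\<dots> = al * la" unfolding X_def using La by simp
  finally show ?thesis using that h \<sigma> hK hal by blast
qed

context event_triggered_plant
begin

lemma small_sampling_parameters:
  obtains h \<sigma> where "0 < h" "h \<le> 1" "0 < \<sigma>" "\<sigma> \<le> 1"
    and "window_decay P (\<alpha>0 * la) la m Kv Cv (eta \<sigma> h) h"
proof -
  have "0 \<le> 8 * m * Lf * (2 + m)" using m_nonneg Lf_nonneg by simp
  then obtain h \<sigma> where h\<sigma>: "0 < h" "h \<le> 1" "0 < \<sigma>" "\<sigma> \<le> 1" "h * Kv \<le> 1/4" "h * (\<alpha>0 * la) \<le> m"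
      and small: "64 * m * (8*(\<alpha>0 * la)*h*Kv + 8 * m * Lf * (2 + m) * (\<sigma> + h * Kv) + 8*m*h*Kv\<^sup>2)
        \<le> (\<alpha>0 * la) * la"
    using small_window_parameters[of "\<alpha>0 * la" la m Kv "8 * m * Lf * (2 + m)"]
      \<alpha>0_pos la_pos m_ge_1 Kv_pos by auto
  have eta_eq: "8 * m * Lf * (2 + m) * (\<sigma> + h * Kv) = 4 * eta \<sigma> h" unfolding eta_def by simp
  have "64 * m * (8*(\<alpha>0 * la)*h*Kv + 4 * eta \<sigma> h + 8*m*h*Kv\<^sup>2) \<le> (\<alpha>0 * la) * la"
    using small unfolding eta_eq .
  moreover have "0 \<le> eta \<sigma> h"
    unfolding eta_def using h\<sigma> m_nonneg Lf_nonneg Kv_pos by simp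
  ultimately have "window_decay P (\<alpha>0 * la) la m Kv Cv (eta \<sigma> h) h"
    using h\<sigma> \<alpha>0_pos la_pos m_ge_1 Kv_pos Cv_nonneg quad_lower quad_upper P_commute
    by unfold_locales auto
  with h\<sigma> show ?thesis using that by blast
qed

lemma et_solution_norm_decay:
  assumes W: "window_decay P (\<alpha>0 * la) la m Kv Cv (eta \<sigma> h) h" and h: "h \<le> 1" and \<sigma>: "0 < \<sigma>" "\<sigma> \<le> 1"
    and adm: "admissible \<omega>0 w" and sol: "et_solution A B C Cq E Ew Fw p K1 K2 L1 L2 h \<sigma> 1 h \<sigma> 1 x xh w"
    and t: "0 \<le> t"
  shows "norm (cat (x t) (x t - xh t)) \<le> sqrt (m / la) * norm (cat (x 0) (x 0 - xh 0))
      * exp (- (window_decay.decay_rate (\<alpha>0 * la) m / 2) * t)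
    + sqrt (window_decay.offset (\<alpha>0 * la) la m Kv Cv (eta \<sigma> h) h / la)"
proof -
  interpret W: window_decay P "\<alpha>0 * la" la m Kv Cv "eta \<sigma> h" h by (rule W)
  obtain ty tu ys xhs where
    trY: "trig h \<sigma> 1 (\<lambda>t. C *v x t + Fw *v w t) ty" and hdY: "held ty (\<lambda>t. C *v x t + Fw *v w t) ys"
    and trU: "trig h \<sigma> 1 xh tu" and hdU: "held tu xh xhs"
    and ints: "\<forall>t\<ge>0. ((\<lambda>s. A *v x s + B *v (K1 *v xhs s + K2 *v p (Cq *v xhs s)) + E *v p (Cq *v x s)
           + Ew *v w s) has_integral (x t - x 0)) {0..t} \<and>
        ((\<lambda>s. A *v xh s + B *v (K1 *v xhs s + K2 *v p (Cq *v xhs s))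
           + E *v p (Cq *v xh s + L1 *v (C *v xh s - ys s)) + L2 *v (C *v xh s - ys s))
         has_integral (xh t - xh 0)) {0..t}"
    using sol unfolding et_solution_def Let_def by blast
  interpret T: et_trajectory A B C Cq E Ew Fw p K1 K2 L1 L2 P \<alpha>0 \<mu> \<omega>0 Lp h \<sigma> x xh w ty tu ys xhs
    using W.h_pos h \<sigma> adm trY hdY trU hdU ints
    by unfold_locales (auto simp: admissible_def outp_def plant_field_def observer_field_def ctrl_def)
  interpret Z: window_trajectory P "\<alpha>0 * la" la m Kv Cv "eta \<sigma> h" h T.z T.G
    by unfold_locales (fact T.z_integral T.G_bound T.G_dissipation)+
  show ?thesis using Z.norm_decay[OF t] unfolding T.z_def .
qed

theorem event_triggered_ISpS:
  "\<exists>\<tau>y \<sigma>y \<epsilon>y \<tau>u \<sigma>u \<epsilon>u. \<tau>y > 0 \<and> \<sigma>y > 0 \<and> \<epsilon>y > 0 \<and> \<tau>u > 0 \<and> \<sigma>u > 0 \<and> \<epsilon>u > 0 \<and>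
     ISpS \<omega>0 (et_solution A B C Cq E Ew Fw p K1 K2 L1 L2 \<tau>y \<sigma>y \<epsilon>y \<tau>u \<sigma>u \<epsilon>u)"
proof -
  obtain h \<sigma> where h\<sigma>: "0 < h" "h \<le> 1" "0 < \<sigma>" "\<sigma> \<le> 1"
    and W: "window_decay P (\<alpha>0 * la) la m Kv Cv (eta \<sigma> h) h"
    by (rule small_sampling_parameters)
  interpret W: window_decay P "\<alpha>0 * la" la m Kv Cv "eta \<sigma> h" h by (rule W)
  have "ISpS \<omega>0 (et_solution A B C Cq E Ew Fw p K1 K2 L1 L2 h \<sigma> 1 h \<sigma> 1)"
    by (rule ISpS_of_exponential_bound[OF _ _ _ et_solution_norm_decay[OF W h\<sigma>(2-4)]])
      (use la_pos m_ge_1 W.decay_rate_pos W.offset_nonneg in auto)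
  then show ?thesis using h\<sigma> by (intro exI[of _ h] exI[of _ \<sigma>] exI[of _ "1::real"]) auto
qed

end

theorem theorem5:
  fixes A :: "real^'nx^'nx" and B :: "real^'nu^'nx" and C :: "real^'nx^'ny"
    and Cq :: "real^'nx^'nq" and E :: "real^'np^'nx" and Ew :: "real^'nw^'nx"
    and Fw :: "real^'nw^'ny" and p :: "real^'nq \<Rightarrow> real^'np"
    and K1 :: "real^'nx^'nu" and K2 :: "real^'np^'nu"
    and L1 :: "real^'ny^'nq" and L2 :: "real^'ny^'nx"
    and P :: "real^('nx + 'nx)^('nx + 'nx)"
    and \<alpha>0 \<mu> \<omega>0 Lp :: real
  assumes p0: "p 0 = 0"
    and p_lip: "Lp-lipschitz_on UNIV p"
    and \<omega>0_pos: "\<omega>0 > 0"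
    and \<alpha>0_pos: "\<alpha>0 > 0" and \<mu>_pos: "\<mu> > 0"
    and P_sym: "transpose P = P"
    and P_pos: "\<And>z. z \<noteq> 0 \<Longrightarrow> z \<bullet> (P *v z) > 0"
    and dissip: "\<And>x xh w.
       let u = K1 *v xh + K2 *v p (Cq *v xh);
           y = C *v x + Fw *v w;
           xd = A *v x + B *v u + E *v p (Cq *v x) + Ew *v w;
           xhd = A *v xh + B *v u + E *v p (Cq *v xh + L1 *v (C *v xh - y)) + L2 *v (C *v xh - y);
           z = cat x (x - xh);
           zd = cat xd (xd - xhd)
       in zd \<bullet> (P *v z) + z \<bullet> (P *v zd) \<le> - \<alpha>0 * (z \<bullet> (P *v z)) + \<mu> * (norm w)\<^sup>2"
  shows "\<exists>\<tau>y \<sigma>y \<epsilon>y \<tau>u \<sigma>u \<epsilon>u. \<tau>y > 0 \<and> \<sigma>y > 0 \<and> \<epsilon>y > 0 \<and> \<tau>u > 0 \<and> \<sigma>u > 0 \<and> \<epsilon>u > 0 \<and>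
     ISpS \<omega>0 (et_solution A B C Cq E Ew Fw p K1 K2 L1 L2 \<tau>y \<sigma>y \<epsilon>y \<tau>u \<sigma>u \<epsilon>u)"
proof -
  interpret event_triggered_plant A B C Cq E Ew Fw p K1 K2 L1 L2 P \<alpha>0 \<mu> \<omega>0 Lp
    using assms by unfold_locales
  show ?thesis by (rule event_triggered_ISpS)
qed

end
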